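(* Let $\Gamma$ be a metric graph, let $q\in\Gamma$, let $D$ be a divisor on $\Gamma$ such that $D(p)\ge 0$ for all $p\ne q$, and let $(f_i)_{i\ge 0}$ be an infinite sequence of maximal legal firings reducing $D$ with respect to $q$; that is, with $D_0=D$ and $D_{i+1}=D_i-Q(f_i)$, each $f_i$ is a maximal legal firing towards $q$ for $D_i$. Then the series of functions $\sum_{i} f_i$ converges (i.e. $\sum_i f_i(p)$ converges for every $p\in\Gamma$), and the greedy reduction has a well-defined limit, i.e. the sequence of divisors $(D_i)_{i\ge 0}$ converges to a divisor on $\Gamma$.
   Context: A metric graph $\Gamma$ is a compact connected metric space obtained from a finite edge-weighted graph by viewing each edge of weight $w>0$ as a segment of length $w$ (with the path metric). The degree of a point $p\in\Gamma$ is the number of tangent directions at $p$; a combinatorial vertex is a point of degree other than $2$. A divisor $D$ on $\Gamma$ is a formal integer combination of points of $\Gamma$ with finitely many nonzero coefficients; $D(p)$ is the coefficient (number of chips) at $p$. Fix $q\in\Gamma$. A (basic) firing $f$ towards $q$ of length $\epsilon=\epsilon(f)>0$ is given by two disjoint nonempty connected closed subsets $X,Y\subset\Gamma$ with $q\in X$ such that $Z=\Gamma\setminus(X\cup Y)$ is a disjoint union of finitely many open segments of length $\epsilon$, each having one endpoint in $X$ and the other endpoint in $Y$. The associated function $f:\Gamma\to\mathbb{R}$ is the piecewise affine function equal to $0$ on $X$, equal to $\epsilon$ on $Y$, and of slope $1$ on each segment of $Z$ in the direction from $X$ to $Y$. The divisor $Q(f)$ is $\sum_{I}\big((y_I)-(x_I)\big)$,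 the sum being over the segments $I$ of $Z$, where $x_I\in X$ and $y_I\in Y$ are the endpoints of $I$. Thus passing from $D$ to $D-Q(f)$ pushes one chip along each segment of the cut $Z$ a distance $\epsilon$ from $Y$ to $X$, i.e. towards $q$. For a divisor $D$ with $D(p)\ge0$ for all $p\neq q$, the firing $f$ is legal for $D$ if $D-Q(f)$ is also nonnegative at all points other than $q$. It is a maximal legal firing for $D$ if it is legal and its length is maximum for the given cut, i.e. there is no legal firing towards $q$ for $D$ with the same set $Y$ and strictly larger length (equivalently, at least one of the pushed chips hits a combinatorial vertex or $q$, and so cannot be pushed further without choosing a different cut). A greedy reduction of $D=D_0$ with respect to $q$ is a sequence of divisors $D_i$ with $D_i=D_{i-1}-Q(f_{i-1})$, where each $f_{i-1}$ is a maximal legal firing towards $q$ for $D_{i-1}$. Convergence of divisors: firings towards $q$ never decrease the coefficient at $q$ and preserve the sum of coefficients, so with $N=\max(0,-D(q))$ every $D_i+N(q)$ is a sum of a fixed number $m$ of points of $\Gamma$. The sequence $D_i$ converges to $D_\infty$ if one can write $D_i+N(q)=\sum_{j=1}^m (x_{i,j})$ and $D_\infty+N(q)=\sum_{j=1}^m(x_{\infty,j})$ with $x_{i,j}\to x_{\infty,j}$ in $\Gamma$ as $i\to\infty$ for each $j$. *)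

theory Defs
  imports "HOL-Analysis.Analysis" "HOL-Library.Poly_Mapping"
begin

section \<open>Metric graphs\<close>

text \<open>
  An edge of weight \<open>w e\<close> is presented by a map \<open>\<phi> e\<close> from the interval \<open>{0..w e}\<close>.
  A walk is a finite concatenation of subsegments of edges; \<open>edge_walk n w \<phi> x y l\<close> says that
  there is one of total length \<open>l\<close> from \<open>x\<close> to \<open>y\<close>.
\<close>

inductive edge_walk ::
  "nat \<Rightarrow> (nat \<Rightarrow> real) \<Rightarrow> (nat \<Rightarrow> real \<Rightarrow> 'a) \<Rightarrow> 'a \<Rightarrow> 'a \<Rightarrow> real \<Rightarrow> bool"
  for n w \<phi> where
  stay: "edge_walk n w \<phi> x x 0"
| step: "e < n \<Longrightarrow> s \<in> {0..w e} \<Longrightarrow> t \<in> {0..w e} \<Longrightarrow> edge_walk n w \<phi> (\<phi> e t) y l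
          \<Longrightarrow> edge_walk n w \<phi> (\<phi> e s) y (\<bar>s - t\<bar> + l)"

text \<open>
  \<open>\<Gamma>\<close> is the space glued from a finite weighted graph with vertex set \<open>V\<close> and edges
  \<open>0, \<dots>, n - 1\<close>; loops and multiple edges are allowed. The endpoints of the edge \<open>e\<close> are
  \<open>\<phi> e 0\<close> and \<open>\<phi> e (w e)\<close>, and the last conjunct says that the distance is the path metric.
  The ambient type imposes no restriction on \<open>\<Gamma>\<close>: only the distance between points of \<open>\<Gamma>\<close> matters.
\<close>

definition metric_graph :: "'a::metric_space set \<Rightarrow> bool" where
  "metric_graph \<Gamma> \<longleftrightarrow> compact \<Gamma> \<and> connected \<Gamma> \<and>
     (\<exists>V n w \<phi>.
        finite V \<and>
        (\<forall>e<n. 0 < w e \<and> \<phi> e 0 \<in> V \<and> \<phi> e (w e) \<in> V) \<and>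
        (\<forall>e<n. \<forall>t\<in>{0<..<w e}. \<phi> e t \<notin> V) \<and>
        inj_on (\<lambda>(e, t). \<phi> e t) (SIGMA e:{..<n}. {0<..<w e}) \<and>
        \<Gamma> = V \<union> (\<Union>e<n. \<phi> e ` {0..w e}) \<and>
        (\<forall>x\<in>\<Gamma>. \<forall>y\<in>\<Gamma>. (\<exists>l. edge_walk n w \<phi> x y l) \<and>
                      dist x y = Inf {l. edge_walk n w \<phi> x y l}))"


section \<open>Divisors\<close>

definition divisor_on :: "'a set \<Rightarrow> ('a \<Rightarrow>\<^sub>0 int) \<Rightarrow> bool" where
  "divisor_on \<Gamma> D \<longleftrightarrow> Poly_Mapping.keys D \<subseteq> \<Gamma>"

definition nonneg_off :: "'a \<Rightarrow> ('a \<Rightarrow>\<^sub>0 int) \<Rightarrow> bool" where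
  "nonneg_off q D \<longleftrightarrow> (\<forall>p. p \<noteq> q \<longrightarrow> 0 \<le> Poly_Mapping.lookup D p)"

text \<open>
  Convergence of divisors all of which become sums of \<open>m\<close> points of \<open>\<Gamma>\<close> after adding \<open>N\<close> times
  the point \<open>q\<close>.
\<close>

definition divisors_converge ::
  "'a::metric_space set \<Rightarrow> 'a \<Rightarrow> int \<Rightarrow> (nat \<Rightarrow> ('a \<Rightarrow>\<^sub>0 int)) \<Rightarrow> ('a \<Rightarrow>\<^sub>0 int) \<Rightarrow> bool" where
  "divisors_converge \<Gamma> q N D Dlim \<longleftrightarrow>
     (\<exists>(m::nat) x xlim.
        (\<forall>i. D i + Poly_Mapping.single q N = (\<Sum>j<m. frag_of (x i j))) \<and>
        Dlim + Poly_Mapping.single q N = (\<Sum>j<m. frag_of (xlim j)) \<and>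
        (\<forall>j<m. (\<forall>i. x i j \<in> \<Gamma>) \<and> xlim j \<in> \<Gamma> \<and> (\<lambda>i. x i j) \<longlonglongrightarrow> xlim j))"


section \<open>Firings\<close>

text \<open>
  The closed sets \<open>fX\<close>, \<open>fY\<close> determine the remaining components up to the numbering of the
  segments: \<open>fseg f k\<close>, for \<open>k < fnum f\<close>, traverses the \<open>k\<close>-th segment of \<open>\<Gamma> - (fX f \<union> fY f)\<close>
  at unit speed on the interval \<open>{0..flen f}\<close>, from \<open>fX f\<close> to \<open>fY f\<close>.
\<close>

record 'a firing =
  fX :: "'a set"
  fY :: "'a set"
  flen :: real
  fnum :: nat
  fseg :: "nat \<Rightarrow> real \<Rightarrow> 'a"

text \<open>
  Only a local isometry is required: the distance in \<open>\<Gamma>\<close> between the ends of a segment can be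
  smaller than the length of the segment.
\<close>

definition unit_speed :: "real \<Rightarrow> (real \<Rightarrow> 'a::metric_space) \<Rightarrow> bool" where
  "unit_speed \<epsilon> \<gamma> \<longleftrightarrow> continuous_on {0..\<epsilon>} \<gamma> \<and>
     (\<forall>t\<in>{0<..<\<epsilon>}. \<exists>\<delta>>0. \<forall>s\<in>{0<..<\<epsilon>} \<inter> ball t \<delta>. \<forall>s'\<in>{0<..<\<epsilon>} \<inter> ball t \<delta>.
        dist (\<gamma> s) (\<gamma> s') = \<bar>s - s'\<bar>)"

definition firing_towards :: "'a::metric_space set \<Rightarrow> 'a \<Rightarrow> 'a firing \<Rightarrow> bool" where
  "firing_towards \<Gamma> q f \<longleftrightarrow>
     closedin (top_of_set \<Gamma>) (fX f) \<and> connected (fX f) \<and> fX f \<noteq> {} \<and>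
     closedin (top_of_set \<Gamma>) (fY f) \<and> connected (fY f) \<and> fY f \<noteq> {} \<and>
     fX f \<inter> fY f = {} \<and> q \<in> fX f \<and> 0 < flen f \<and>
     (\<forall>k<fnum f. unit_speed (flen f) (fseg f k) \<and>
                 fseg f k 0 \<in> fX f \<and> fseg f k (flen f) \<in> fY f) \<and>
     inj_on (\<lambda>(k, t). fseg f k t) ({..<fnum f} \<times> {0<..<flen f}) \<and>
     \<Gamma> - (fX f \<union> fY f) = (\<Union>k<fnum f. fseg f k ` {0<..<flen f})"

definition firing_fun :: "'a firing \<Rightarrow> 'a \<Rightarrow> real" where
  "firing_fun f p =
     (if p \<in> fX f then 0
      else if p \<in> fY f then flen f
      else (THE t. t \<in> {0<..<flen f} \<and> (\<exists>k<fnum f. fseg f k t = p)))"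

definition firing_div :: "'a firing \<Rightarrow> ('a \<Rightarrow>\<^sub>0 int)" where
  "firing_div f = (\<Sum>k<fnum f. frag_of (fseg f k (flen f)) - frag_of (fseg f k 0))"

definition legal_firing :: "'a::metric_space set \<Rightarrow> 'a \<Rightarrow> ('a \<Rightarrow>\<^sub>0 int) \<Rightarrow> 'a firing \<Rightarrow> bool" where
  "legal_firing \<Gamma> q D f \<longleftrightarrow> firing_towards \<Gamma> q f \<and> nonneg_off q (D - firing_div f)"

definition maximal_legal_firing ::
  "'a::metric_space set \<Rightarrow> 'a \<Rightarrow> ('a \<Rightarrow>\<^sub>0 int) \<Rightarrow> 'a firing \<Rightarrow> bool" where
  "maximal_legal_firing \<Gamma> q D f \<longleftrightarrow> legal_firing \<Gamma> q D f \<and>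
     \<not> (\<exists>g. legal_firing \<Gamma> q D g \<and> fY g = fY f \<and> flen f < flen g)"

end

theory Submission imports Defs begin

text \<open>
  On piecewise affine functions there is the Dirichlet form \<open>E(u, v) = \<integral> u' v'\<close>, and for a firing
  \<open>f\<close> one has \<open>E(f, u) = \<langle>Q(f), u\<rangle>\<close>, where \<open>\<langle>D, u\<rangle> = \<Sum> D(p) u(p)\<close>. Put
  \<open>F = f\<^sub>0 + \<dots> + f\<^bsub>i-1\<^esub>\<close>, and let \<open>k\<close> and \<open>\<epsilon>\<close> be the number of segments and the length
  of \<open>f\<^sub>i\<close>. Then \<open>E(F, f\<^sub>i) = \<langle>D - D\<^sub>i, f\<^sub>i\<rangle>\<close> by linearity, and
  \<open>k \<epsilon> = E(f\<^sub>i, f\<^sub>i) = \<langle>Q(f\<^sub>i), f\<^sub>i\<rangle> \<le> \<langle>D\<^sub>i, f\<^sub>i\<rangle>\<close> by legality, because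
  \<open>f\<^sub>i\<close> is nonnegative and vanishes at \<open>q\<close>. As \<open>E\<close> is symmetric, expanding
  \<open>E(F + f\<^sub>i, F + f\<^sub>i)\<close> gives
  \<open>E(F + f\<^sub>i, F + f\<^sub>i) + k \<epsilon> \<le> E(F, F) + 2 \<langle>D, f\<^sub>i\<rangle>\<close>, so for all partial sums \<open>F\<close> both
  \<open>E(F, F)\<close> and the total distance \<open>\<Sum> k \<epsilon>\<close> travelled by the chips are at most
  \<open>2 \<langle>D, F\<rangle>\<close>. By Cauchy-Schwarz along a walk from \<open>q\<close>, \<open>\<bar>F(p)\<bar> \<le> C\<^sub>p \<surd>E(F, F)\<close>, hence
  \<open>E(F, F)\<close> is bounded. Therefore the nonnegative series \<open>\<Sum> f\<^sub>i(p)\<close> has bounded partial sums,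
  and every chip moves a finite total distance, so its positions form a Cauchy sequence.
\<close>

section \<open>Edges as local charts\<close>

lemma edge_walk_nonneg: "edge_walk n w \<phi> x y l \<Longrightarrow> 0 \<le> l"
  by (induction rule: edge_walk.induct) auto

text \<open>Fixes one of the presentations whose existence \<open>metric_graph\<close> asserts;
  slopes and energies below refer to it.\<close>

locale edge_presentation =
  fixes \<Gamma> :: "'a::metric_space set" and V :: "'a set" and n :: nat
    and w :: "nat \<Rightarrow> real" and \<phi> :: "nat \<Rightarrow> real \<Rightarrow> 'a"
  assumes compact_\<Gamma>: "compact \<Gamma>"
    and finite_V: "finite V"
    and w_pos: "e < n \<Longrightarrow> 0 < w e"
    and ends_in_V: "e < n \<Longrightarrow> \<phi> e 0 \<in> V" "e < n \<Longrightarrow> \<phi> e (w e) \<in> V"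
    and interior_notin_V: "e < n \<Longrightarrow> t \<in> {0<..<w e} \<Longrightarrow> \<phi> e t \<notin> V"
    and inj_interior: "inj_on (\<lambda>(e, t). \<phi> e t) (SIGMA e:{..<n}. {0<..<w e})"
    and \<Gamma>_eq: "\<Gamma> = V \<union> (\<Union>e<n. \<phi> e ` {0..w e})"
    and walk_exists: "x \<in> \<Gamma> \<Longrightarrow> y \<in> \<Gamma> \<Longrightarrow> \<exists>l. edge_walk n w \<phi> x y l"
    and dist_eq_Inf: "x \<in> \<Gamma> \<Longrightarrow> y \<in> \<Gamma> \<Longrightarrow> dist x y = Inf {l. edge_walk n w \<phi> x y l}"
begin

lemma edge_in_\<Gamma>: "e < n \<Longrightarrow> s \<in> {0..w e} \<Longrightarrow> \<phi> e s \<in> \<Gamma>"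
  unfolding \<Gamma>_eq by blast

text \<open>An end of an edge lies in \<open>V\<close> and an interior point does not, so the second
  parameter is interior as well and \<open>inj_interior\<close> applies.\<close>

lemma interior_unique:
  assumes "e < n" "s \<in> {0<..<w e}" "e' < n" "s' \<in> {0..w e'}" "\<phi> e s = \<phi> e' s'"
  shows "e' = e \<and> s' = s"
proof -
  have "\<phi> e' s' \<notin> V" using interior_notin_V[OF assms(1,2)] assms(5) by simp
  then have "s' \<noteq> 0" "s' \<noteq> w e'" using ends_in_V[OF assms(3)] by auto
  then have "s' \<in> {0<..<w e'}" using assms(4) by auto
  then show ?thesis
    using inj_onD[OF inj_interior, of "(e, s)" "(e', s')"] assms by auto
qed

lemma inj_on_edge: "e < n \<Longrightarrow> inj_on (\<phi> e) {0<..<w e}"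
  using interior_unique by (fastforce simp: inj_on_def)

text \<open>An edge can be left only through one of its ends, and reaching an end from
  \<open>s\<close> costs at least \<open>min s (w e - s)\<close>. The second disjunct absorbs
  everything that the walk does after such an exit.\<close>

lemma walk_from_interior:
  assumes "edge_walk n w \<phi> x y l" "e < n"
  shows "s \<in> {0<..<w e} \<Longrightarrow> x = \<phi> e s \<Longrightarrow>
    (\<exists>s'\<in>{0<..<w e}. y = \<phi> e s' \<and> \<bar>s - s'\<bar> \<le> l) \<or> min s (w e - s) \<le> l"
  using assms(1)
proof (induction arbitrary: s rule: edge_walk.induct)
  case (stay x)
  then show ?case by fastforce
next
  case (step e' a t y l)
  have l: "0 \<le> l" by (rule edge_walk_nonneg[OF step.hyps(4)])
  have "\<phi> e s = \<phi> e' a" using step.prems by simp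
  with interior_unique[OF assms(2) step.prems(1) step.hyps(1,2)] have [simp]: "e' = e" "a = s"
    by auto
  show ?case
  proof (cases "t \<in> {0<..<w e}")
    case True
    have "(\<exists>s'\<in>{0<..<w e}. y = \<phi> e s' \<and> \<bar>t - s'\<bar> \<le> l) \<or> min t (w e - t) \<le> l"
      using step.IH[OF True] by simp
    then show ?thesis
    proof
      assume "\<exists>s'\<in>{0<..<w e}. y = \<phi> e s' \<and> \<bar>t - s'\<bar> \<le> l"
      then show ?thesis by fastforce
    next
      assume "min t (w e - t) \<le> l"
      then have "min s (w e - s) \<le> \<bar>a - t\<bar> + l" by simp
      then show ?thesis by blast
    qed
  next
    case False
    then have "t = 0 \<or> t = w e" using step.hyps by auto
    then show ?thesis using l step.prems by auto
  qed
qed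

lemma dist_edge_le:
  assumes "e < n" "s \<in> {0..w e}" "t \<in> {0..w e}"
  shows "dist (\<phi> e s) (\<phi> e t) \<le> \<bar>s - t\<bar>"
proof -
  have "edge_walk n w \<phi> (\<phi> e s) (\<phi> e t) (\<bar>s - t\<bar> + 0)"
    using assms by (intro edge_walk.intros)
  moreover have "bdd_below {l. edge_walk n w \<phi> (\<phi> e s) (\<phi> e t) l}"
    using edge_walk_nonneg by fastforce
  ultimately show ?thesis
    using dist_eq_Inf edge_in_\<Gamma> assms by (simp add: cInf_lower)
qed

lemma continuous_on_edge:
  assumes "e < n" shows "continuous_on {0..w e} (\<phi> e)"
proof (rule continuous_onI)
  fix s d :: real assume s: "s \<in> {0..w e}" "0 < d"
  show "\<exists>d'>0. \<forall>r\<in>{0..w e}. dist r s < d' \<longrightarrow> dist (\<phi> e r) (\<phi> e s) \<le> d"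
  proof (intro exI[of _ d] conjI ballI impI)
    fix r assume "r \<in> {0..w e}" "dist r s < d"
    then show "dist (\<phi> e r) (\<phi> e s) \<le> d"
      using dist_edge_le[OF assms, of r s] s by (simp add: dist_real_def)
  qed (use s in auto)
qed

text \<open>Walks shorter than the distance to the ends stay inside the edge, so a small ball around
  an interior point contains only points of the same edge, at their parameter distance.\<close>

lemma near_interior:
  assumes e: "e < n" and s: "s \<in> {0<..<w e}" and y: "y \<in> \<Gamma>"
    and d: "dist (\<phi> e s) y < min s (w e - s)"
  obtains s' where "s' \<in> {0<..<w e}" "y = \<phi> e s'" "\<bar>s - s'\<bar> = dist (\<phi> e s) y"
proof -
  let ?L = "{l. edge_walk n w \<phi> (\<phi> e s) y l}"
  have sG: "\<phi> e s \<in> \<Gamma>" using e s edge_in_\<Gamma> by auto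
  have ne: "?L \<noteq> {}" using walk_exists[OF sG y] by auto
  have eq: "dist (\<phi> e s) y = Inf ?L" using dist_eq_Inf[OF sG y] .
  obtain l where l: "l \<in> ?L" "l < min s (w e - s)"
    using d eq cInf_lessD[OF ne] by metis
  obtain s' where s': "s' \<in> {0<..<w e}" "y = \<phi> e s'"
    using walk_from_interior[OF _ e s refl, of y l] l by fastforce
  \<comment> \<open>A walk too short to leave the edge ends at the same parameter \<open>s'\<close>
    by injectivity; any other walk is longer than \<open>l\<close>, which already bounds
    \<open>\<bar>s - s'\<bar>\<close>.\<close>
  have "\<bar>s - s'\<bar> \<le> m" if m: "m \<in> ?L" for m
  proof (cases "m < min s (w e - s)")
    case True
    then obtain s'' where "s'' \<in> {0<..<w e}" "y = \<phi> e s''" "\<bar>s - s''\<bar> \<le> m"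
      using walk_from_interior[OF _ e s refl, of y m] m by fastforce
    moreover from this have "s'' = s'" using inj_onD[OF inj_on_edge[OF e]] s' by metis
    ultimately show ?thesis by simp
  next
    case False
    obtain s'' where "s'' \<in> {0<..<w e}" "y = \<phi> e s''" "\<bar>s - s''\<bar> \<le> l"
      using walk_from_interior[OF _ e s refl, of y l] l by fastforce
    moreover from this have "s'' = s'" using inj_onD[OF inj_on_edge[OF e]] s' by metis
    ultimately show ?thesis using False l(2) by linarith
  qed
  then have "\<bar>s - s'\<bar> \<le> Inf ?L" by (intro cInf_greatest ne)
  moreover have "dist (\<phi> e s) y \<le> \<bar>s - s'\<bar>" using dist_edge_le[OF e, of s s'] s s' by auto
  ultimately show ?thesis using that[OF s'] eq by simp
qed

lemma dist_edge_eq: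
  assumes e: "e < n" and s: "s \<in> {0<..<w e}" and s': "s' \<in> {0..w e}"
    and d: "\<bar>s - s'\<bar> < min s (w e - s)"
  shows "dist (\<phi> e s) (\<phi> e s') = \<bar>s - s'\<bar>"
proof -
  have "dist (\<phi> e s) (\<phi> e s') < min s (w e - s)"
    using dist_edge_le[OF e _ s', of s] s d by auto
  then obtain s'' where "s'' \<in> {0<..<w e}" "\<phi> e s' = \<phi> e s''"
    "\<bar>s - s''\<bar> = dist (\<phi> e s) (\<phi> e s')"
    using near_interior[OF e s edge_in_\<Gamma>[OF e s']] by metis
  then show ?thesis using interior_unique[OF e _ e s', of s''] by auto
qed

text \<open>Read in the chart \<open>\<phi> e\<close>, a unit speed path is near \<open>t\<close> a
  distance preserving map between intervals of the line, hence a translation or a reflection;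
  \<open>\<sigma>\<close> is its direction.\<close>

lemma unit_speed_along_edge:
  assumes e: "e < n" and s: "s \<in> {0<..<w e}" and us: "unit_speed \<epsilon> \<gamma>"
    and sub: "\<gamma> ` {0<..<\<epsilon>} \<subseteq> \<Gamma>" and t: "t \<in> {0<..<\<epsilon>}" and eq: "\<gamma> t = \<phi> e s"
  obtains \<sigma> \<delta> :: real where "\<sigma> = 1 \<or> \<sigma> = -1" "0 < \<delta>"
    "\<And>u. \<bar>u\<bar> < \<delta> \<Longrightarrow> t + u \<in> {0<..<\<epsilon>} \<and> s + \<sigma> * u \<in> {0<..<w e} \<and> \<gamma> (t + u) = \<phi> e (s + \<sigma> * u)"
proof -
  obtain d where d: "0 < d" "\<And>a b. a \<in> {0<..<\<epsilon>} \<inter> ball t d \<Longrightarrow> b \<in> {0<..<\<epsilon>} \<inter> ball t d \<Longrightarrow>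
      dist (\<gamma> a) (\<gamma> b) = \<bar>a - b\<bar>"
    using us t unfolding unit_speed_def by meson
  define m where "m = min s (w e - s)"
  have m: "0 < m" using s by (auto simp: m_def)
  \<comment> \<open>With \<open>m / 3\<close>, parameters reached within time
    \<open>\<delta>\<close> stay at least \<open>2 * \<delta>\<close> away from both ends, while two
    of them are less than \<open>2 * \<delta>\<close> apart, so \<open>dist_edge_eq\<close> will
    apply.\<close>
  define \<delta> where "\<delta> = min (min d t) (min (\<epsilon> - t) (m / 3))"
  have \<delta>: "0 < \<delta>" "\<delta> \<le> d" "\<delta> \<le> t" "\<delta> \<le> \<epsilon> - t" "\<delta> \<le> m / 3"
    using d t m unfolding \<delta>_def greaterThanLessThan_iff by linarith+
  have near: "t + u \<in> {0<..<\<epsilon>} \<inter> ball t d" if "\<bar>u\<bar> < \<delta>" for u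
    using that \<delta> by (auto simp: dist_real_def)
  have "\<exists>r\<in>{0<..<w e}. \<gamma> (t + u) = \<phi> e r \<and> \<bar>s - r\<bar> = \<bar>u\<bar>" if u: "\<bar>u\<bar> < \<delta>" for u
  proof -
    have dd: "dist (\<phi> e s) (\<gamma> (t + u)) = \<bar>u\<bar>"
      using d(2)[OF _ near[OF u], of t] t d(1) eq by auto
    have "\<gamma> (t + u) \<in> \<Gamma>" using near[OF u] sub by auto
    moreover have "\<bar>u\<bar> < min s (w e - s)" using u \<delta>(5) m unfolding m_def[symmetric] by auto
    ultimately show ?thesis using near_interior[OF e s, of "\<gamma> (t + u)"] dd by metis
  qed
  then obtain r where r: "\<And>u. \<bar>u\<bar> < \<delta> \<Longrightarrow> r u \<in> {0<..<w e}"
    "\<And>u. \<bar>u\<bar> < \<delta> \<Longrightarrow> \<gamma> (t + u) = \<phi> e (r u)" "\<And>u. \<bar>u\<bar> < \<delta> \<Longrightarrow> \<bar>s - r u\<bar> = \<bar>u\<bar>"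
    by metis
  have iso: "\<bar>r u - r v\<bar> = \<bar>u - v\<bar>" if "\<bar>u\<bar> < \<delta>" "\<bar>v\<bar> < \<delta>" for u v
  proof -
    have "\<bar>r u - r v\<bar> < 2 * \<delta>" using r(3)[OF that(1)] r(3)[OF that(2)] that by linarith
    moreover have "2 * \<delta> \<le> min (r u) (w e - r u)"
      using r(3)[OF that(1)] that \<delta>(5) unfolding m_def by auto
    ultimately have "dist (\<phi> e (r u)) (\<phi> e (r v)) = \<bar>r u - r v\<bar>"
      using dist_edge_eq[OF e r(1)[OF that(1)], of "r v"] r(1)[OF that(2)] by auto
    then show ?thesis
      using d(2)[OF near[OF that(1)] near[OF that(2)]] r(2) that by simp
  qed
  \<comment> \<open>The direction is read off at the single time \<open>\<delta>/2\<close>: an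
    isometry of the line is determined by its values at two points, here \<open>0\<close> and
    \<open>\<delta>/2\<close>.\<close>
  define \<sigma> :: real where "\<sigma> = (if r (\<delta>/2) = s + \<delta>/2 then 1 else -1)"
  have half: "r (\<delta>/2) = s + \<sigma> * (\<delta>/2)" 
  proof -
    have "\<bar>s - r (\<delta>/2)\<bar> = \<delta>/2" using r(3)[of "\<delta>/2"] \<delta>(1) by simp
    then have "r (\<delta>/2) = s + \<delta>/2 \<or> r (\<delta>/2) = s - \<delta>/2" by linarith
    then show ?thesis by (auto simp: \<sigma>_def)
  qed
  have \<sigma>: "\<sigma> = 1 \<or> \<sigma> = -1" by (simp add: \<sigma>_def)
  have "r u = s + \<sigma> * u" if u: "\<bar>u\<bar> < \<delta>" for u
    using r(3)[OF u] iso[of u "\<delta>/2"] u \<delta>(1) half \<sigma> by auto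
  then show ?thesis using that[OF \<sigma> \<delta>(1)] near r by auto
qed

end

section \<open>Dirichlet energy of piecewise affine functions\<close>

text \<open>Stronger than having derivative \<open>c\<close> at \<open>s\<close>: the function
  equals its tangent on a whole neighbourhood, which makes the slope locally constant.\<close>

definition affine_near :: "(real \<Rightarrow> real) \<Rightarrow> real \<Rightarrow> real \<Rightarrow> bool" where
  "affine_near h s c \<longleftrightarrow> (\<forall>\<^sub>F r in nhds s. h r = h s + c * (r - s))"

lemma affine_nearI:
  assumes "0 < \<delta>" "\<And>u. \<bar>u\<bar> < \<delta> \<Longrightarrow> h (s + u) = h s + c * u"
  shows "affine_near h s c"
  unfolding affine_near_def eventually_nhds_metric
proof (intro exI[of _ \<delta>] conjI allI impI)
  fix r assume "dist r s < \<delta>"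
  then show "h r = h s + c * (r - s)" using assms(2)[of "r - s"] by (simp add: dist_real_def)
qed fact

lemma affine_near_add:
  "affine_near h s c \<Longrightarrow> affine_near k s d \<Longrightarrow> affine_near (\<lambda>r. h r + k r) s (c + d)"
  unfolding affine_near_def by (erule (1) eventually_elim2) (simp add: algebra_simps)

lemma affine_near_DERIV:
  assumes "affine_near h s c" shows "(h has_real_derivative c) (at s)"
proof -
  have "((\<lambda>r. h s + c * (r - s)) has_real_derivative c) (at s)"
    by (auto intro!: derivative_eq_intros)
  then show ?thesis
    using DERIV_cong_ev[OF refl assms[unfolded affine_near_def] refl] by simp
qed

lemma eventually_affine_near:
  assumes "affine_near h s c" shows "\<forall>\<^sub>F r in nhds s. affine_near h r c"
proof -
  have "\<forall>\<^sub>F r in nhds s. \<forall>\<^sub>F r' in nhds r. h r' = h s + c * (r' - s)"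
    using assms unfolding affine_near_def eventually_eventually .
  then show ?thesis
  proof eventually_elim
    case (elim r)
    have "h r = h s + c * (r - s)" using eventually_nhds_x_imp_x[OF elim] .
    with elim show ?case
      unfolding affine_near_def by (auto elim!: eventually_mono simp: algebra_simps)
  qed
qed

context edge_presentation
begin

text \<open>One finite set of breakpoints serves all edges, and the uniform bound \<open>K\<close>
  on the slopes yields integrability of their products.\<close>

definition pw_affine :: "('a \<Rightarrow> real) \<Rightarrow> bool" where
  "pw_affine u \<longleftrightarrow> continuous_on \<Gamma> u \<and>
     (\<exists>S K. finite S \<and> (\<forall>e<n. \<forall>s\<in>{0<..<w e} - S. \<exists>c. \<bar>c\<bar> \<le> K \<and> affine_near (\<lambda>r. u (\<phi> e r)) s c))"

text \<open>At a breakpoint this is an unspecified value, harmless because integrals ignore finite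
  sets.\<close>

definition slope :: "('a \<Rightarrow> real) \<Rightarrow> nat \<Rightarrow> real \<Rightarrow> real" where
  "slope u e s = deriv (\<lambda>r. u (\<phi> e r)) s"

definition energy :: "('a \<Rightarrow> real) \<Rightarrow> ('a \<Rightarrow> real) \<Rightarrow> real" where
  "energy u v = (\<Sum>e<n. integral {0<..<w e} (\<lambda>s. slope u e s * slope v e s))"

lemma slope_eqI: "affine_near (\<lambda>r. u (\<phi> e r)) s c \<Longrightarrow> slope u e s = c"
  unfolding slope_def using affine_near_DERIV DERIV_imp_deriv by blast

lemma pw_affineE:
  assumes "pw_affine u"
  obtains S K where "finite S" "0 \<le> K"
    "\<And>e s. e < n \<Longrightarrow> s \<in> {0<..<w e} - S \<Longrightarrow> affine_near (\<lambda>r. u (\<phi> e r)) s (slope u e s)"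
    "\<And>e s. e < n \<Longrightarrow> s \<in> {0<..<w e} - S \<Longrightarrow> \<bar>slope u e s\<bar> \<le> K"
proof -
  obtain S K where S: "finite S" and
    *: "\<And>e s. e < n \<Longrightarrow> s \<in> {0<..<w e} - S \<Longrightarrow> \<exists>c. \<bar>c\<bar> \<le> K \<and> affine_near (\<lambda>r. u (\<phi> e r)) s c"
    using assms unfolding pw_affine_def by metis
  show ?thesis
  proof (rule that[OF S, of "\<bar>K\<bar>"])
    fix e s assume "e < n" "s \<in> {0<..<w e} - S"
    then obtain c where c: "\<bar>c\<bar> \<le> K" "affine_near (\<lambda>r. u (\<phi> e r)) s c" using * by metis
    then show "affine_near (\<lambda>r. u (\<phi> e r)) s (slope u e s)" "\<bar>slope u e s\<bar> \<le> \<bar>K\<bar>"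
      using slope_eqI[of u e s c] by auto
  qed simp
qed

section \<open>Sums of piecewise affine functions and bilinearity of the energy\<close>

lemma pw_affine_zero: "pw_affine (\<lambda>p. 0)"
  unfolding pw_affine_def affine_near_def
  by (intro conjI exI[of _ "{}"] exI[of _ 0]) auto

lemma pw_affine_add:
  assumes "pw_affine u" "pw_affine v" shows "pw_affine (\<lambda>p. u p + v p)"
proof -
  from assms(1) obtain S K where S: "finite S"
    "\<And>e s. e < n \<Longrightarrow> s \<in> {0<..<w e} - S \<Longrightarrow> affine_near (\<lambda>r. u (\<phi> e r)) s (slope u e s)"
    "\<And>e s. e < n \<Longrightarrow> s \<in> {0<..<w e} - S \<Longrightarrow> \<bar>slope u e s\<bar> \<le> K"
    by (rule pw_affineE) blast
  from assms(2) obtain T L where T: "finite T"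
    "\<And>e s. e < n \<Longrightarrow> s \<in> {0<..<w e} - T \<Longrightarrow> affine_near (\<lambda>r. v (\<phi> e r)) s (slope v e s)"
    "\<And>e s. e < n \<Longrightarrow> s \<in> {0<..<w e} - T \<Longrightarrow> \<bar>slope v e s\<bar> \<le> L"
    by (rule pw_affineE) blast
  show ?thesis unfolding pw_affine_def
  proof (intro conjI, goal_cases)
    case 1
    show "continuous_on \<Gamma> (\<lambda>p. u p + v p)"
      using assms unfolding pw_affine_def by (auto intro: continuous_on_add)
  next
    case 2
    have "\<exists>c. \<bar>c\<bar> \<le> K + L \<and> affine_near (\<lambda>r. u (\<phi> e r) + v (\<phi> e r)) s c"
      if "e < n" "s \<in> {0<..<w e} - (S \<union> T)" for e s
      using that S(2,3)[of e s] T(2,3)[of e s]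
      by (intro exI[of _ "slope u e s + slope v e s"] conjI affine_near_add) auto
    then show ?case using S(1) T(1) by (intro exI[of _ "S \<union> T"] exI[of _ "K + L"]) auto
  qed
qed

lemma pw_affine_sum:
  fixes k :: nat
  shows "(\<And>i. i < k \<Longrightarrow> pw_affine (u i)) \<Longrightarrow> pw_affine (\<lambda>p. \<Sum>i<k. u i p)"
  by (induction k) (simp_all add: pw_affine_zero pw_affine_add)

lemma slope_add:
  assumes "pw_affine u" "pw_affine v"
  obtains S where "finite S"
    "\<And>e s. e < n \<Longrightarrow> s \<in> {0<..<w e} - S \<Longrightarrow> slope (\<lambda>p. u p + v p) e s = slope u e s + slope v e s"
proof -
  from assms(1) obtain S where S: "finite S"
    "\<And>e s. e < n \<Longrightarrow> s \<in> {0<..<w e} - S \<Longrightarrow> affine_near (\<lambda>r. u (\<phi> e r)) s (slope u e s)"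
    by (rule pw_affineE) blast
  from assms(2) obtain T where T: "finite T"
    "\<And>e s. e < n \<Longrightarrow> s \<in> {0<..<w e} - T \<Longrightarrow> affine_near (\<lambda>r. v (\<phi> e r)) s (slope v e s)"
    by (rule pw_affineE) blast
  show ?thesis
    by (rule that[of "S \<union> T"]) (use S T in \<open>auto intro!: slope_eqI affine_near_add\<close>)
qed

lemma continuous_on_slope:
  assumes "finite S" "e < n"
    "\<And>s. s \<in> {0<..<w e} - S \<Longrightarrow> affine_near (\<lambda>r. u (\<phi> e r)) s (slope u e s)"
  shows "continuous_on ({0<..<w e} - S) (slope u e)"
proof (rule continuous_at_imp_continuous_on, intro ballI)
  fix s assume s: "s \<in> {0<..<w e} - S"
  have "\<forall>\<^sub>F r in nhds s. slope u e r = slope u e s"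
    using eventually_affine_near[OF assms(3)[OF s]] by eventually_elim (rule slope_eqI)
  then show "isCont (slope u e) s"
    using isCont_cong[of "slope u e" "\<lambda>_. slope u e s" s] by simp
qed

text \<open>Off the breakpoints both slopes are locally constant, hence continuous and measurable,
  and they are bounded; the removed finite set is negligible.\<close>

lemma slope_absolutely_integrable:
  assumes u: "pw_affine u" and v: "pw_affine v" and e: "e < n"
  shows "(\<lambda>s. slope u e s * slope v e s) absolutely_integrable_on {0<..<w e}"
proof -
  from u obtain S K where S: "finite S" "0 \<le> K"
    "\<And>e s. e < n \<Longrightarrow> s \<in> {0<..<w e} - S \<Longrightarrow> affine_near (\<lambda>r. u (\<phi> e r)) s (slope u e s)"
    "\<And>e s. e < n \<Longrightarrow> s \<in> {0<..<w e} - S \<Longrightarrow> \<bar>slope u e s\<bar> \<le> K"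
    by (rule pw_affineE) blast
  from v obtain T L where T: "finite T" "0 \<le> L"
    "\<And>e s. e < n \<Longrightarrow> s \<in> {0<..<w e} - T \<Longrightarrow> affine_near (\<lambda>r. v (\<phi> e r)) s (slope v e s)"
    "\<And>e s. e < n \<Longrightarrow> s \<in> {0<..<w e} - T \<Longrightarrow> \<bar>slope v e s\<bar> \<le> L"
    by (rule pw_affineE) blast
  define U where "U = {0<..<w e} - (S \<union> T)"
  have "open U" unfolding U_def using S T by (auto intro!: open_Diff finite_imp_closed)
  then have U: "U \<in> sets lebesgue" by (simp add: sets_completionI_sets)
  have cu: "continuous_on U (slope u e)"
    using continuous_on_subset[OF continuous_on_slope[OF S(1) e S(3)[OF e]], of U] by (auto simp: U_def)
  have cv: "continuous_on U (slope v e)"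
    using continuous_on_subset[OF continuous_on_slope[OF T(1) e T(3)[OF e]], of U] by (auto simp: U_def)
  have neg: "negligible ({0<..<w e} - U)"
    by (rule negligible_subset[of "S \<union> T"]) (use S T in \<open>auto simp: U_def negligible_finite\<close>)
  have "U \<in> lmeasurable"
    by (rule bounded_set_imp_lmeasurable[OF _ U])
       (rule bounded_subset[of "{0<..<w e}"], auto simp: U_def)
  then have const: "(\<lambda>s. K * L) integrable_on U" by (rule integrable_on_const)
  have meas: "(\<lambda>s. slope u e s * slope v e s) \<in> borel_measurable (lebesgue_on U)"
    using continuous_imp_measurable_on_sets_lebesgue[OF continuous_on_mult[OF cu cv] U] .
  have "(\<lambda>s. slope u e s * slope v e s) absolutely_integrable_on U"
  proof (rule measurable_bounded_by_integrable_imp_absolutely_integrable[OF meas U const])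
    fix s assume "s \<in> U"
    then show "norm (slope u e s * slope v e s) \<le> K * L"
      unfolding real_norm_def abs_mult
      using S(4)[OF e] T(4)[OF e] S(2) by (intro mult_mono) (auto simp: U_def)
  qed
  moreover have "(\<lambda>s. slope u e s * slope v e s) absolutely_integrable_on U \<longleftrightarrow>
      (\<lambda>s. slope u e s * slope v e s) absolutely_integrable_on {0<..<w e}"
    by (rule absolutely_integrable_spike_set_eq) (auto intro!: negligible_subset[OF neg] simp: U_def)
  ultimately show ?thesis by simp
qed

lemma energy_commute: "energy u v = energy v u"
  unfolding energy_def by (simp add: mult.commute)

lemma energy_add_left:
  assumes "pw_affine u" "pw_affine u'" "pw_affine v"
  shows "energy (\<lambda>p. u p + u' p) v = energy u v + energy u' v"
proof -
  obtain S where S: "finite S"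
    "\<And>e s. e < n \<Longrightarrow> s \<in> {0<..<w e} - S \<Longrightarrow> slope (\<lambda>p. u p + u' p) e s = slope u e s + slope u' e s"
    using slope_add[OF assms(1,2)] by metis
  have "integral {0<..<w e} (\<lambda>s. slope (\<lambda>p. u p + u' p) e s * slope v e s) =
      integral {0<..<w e} (\<lambda>s. slope u e s * slope v e s) +
      integral {0<..<w e} (\<lambda>s. slope u' e s * slope v e s)" if e: "e < n" for e
  proof -
    \<comment> \<open>Slopes add only off the finite set \<open>S\<close>, which the integral does
      not see.\<close>
    have "integral {0<..<w e} (\<lambda>s. slope (\<lambda>p. u p + u' p) e s * slope v e s) =
        integral {0<..<w e} (\<lambda>s. slope u e s * slope v e s + slope u' e s * slope v e s)"
      by (rule integral_spike[OF negligible_finite[OF S(1)]])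
        (use S(2)[OF e] in \<open>auto simp: algebra_simps\<close>)
    also have "\<dots> = integral {0<..<w e} (\<lambda>s. slope u e s * slope v e s) +
        integral {0<..<w e} (\<lambda>s. slope u' e s * slope v e s)"
      by (intro integral_add set_lebesgue_integral_eq_integral(1) slope_absolutely_integrable assms e)
    finally show ?thesis .
  qed
  then show ?thesis unfolding energy_def by (simp add: sum.distrib)
qed

lemma energy_zero_left: "energy (\<lambda>p. 0) v = 0"
  unfolding energy_def slope_def by simp

lemma energy_sum_left:
  fixes k :: nat
  assumes "\<And>i. i < k \<Longrightarrow> pw_affine (u i)" "pw_affine v"
  shows "energy (\<lambda>p. \<Sum>i<k. u i p) v = (\<Sum>i<k. energy (u i) v)"
  using assms(1)
  by (induction k) (simp_all add: energy_zero_left energy_add_left pw_affine_sum assms(2))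

section \<open>Energy bounds the oscillation\<close>

lemma slope_has_integral:
  assumes u: "pw_affine u" and e: "e < n" and ab: "0 \<le> a" "a \<le> b" "b \<le> w e"
  shows "(slope u e has_integral (u (\<phi> e b) - u (\<phi> e a))) {a..b}"
proof -
  from u obtain S where S: "finite S"
    "\<And>e s. e < n \<Longrightarrow> s \<in> {0<..<w e} - S \<Longrightarrow> affine_near (\<lambda>r. u (\<phi> e r)) s (slope u e s)"
    by (rule pw_affineE) blast
  show ?thesis
  proof (rule fundamental_theorem_of_calculus_interior_strong[OF S(1) ab(2)])
    fix s assume "s \<in> {a<..<b} - S"
    then have "affine_near (\<lambda>r. u (\<phi> e r)) s (slope u e s)" using S(2)[OF e] ab by auto
    then show "((\<lambda>r. u (\<phi> e r)) has_vector_derivative slope u e s) (at s)"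
      using affine_near_DERIV has_real_derivative_iff_has_vector_derivative by blast
  next
    have "continuous_on {0..w e} (\<lambda>r. u (\<phi> e r))"
      using u edge_in_\<Gamma>[OF e] unfolding pw_affine_def
      by (intro continuous_on_compose2[OF _ continuous_on_edge[OF e]]) auto
    then show "continuous_on {a..b} (\<lambda>r. u (\<phi> e r))"
      by (rule continuous_on_subset) (use ab in auto)
  qed
qed

text \<open>If the square is not integrable, its integral is \<open>0\<close> by convention.\<close>

lemma integral_square_nonneg: "0 \<le> integral T (\<lambda>s::real. g s * g s :: real)"
  by (cases "(\<lambda>s. g s * g s) integrable_on T") (auto simp: integral_nonneg not_integrable_integral)

lemma energy_nonneg: "0 \<le> energy u u"
  unfolding energy_def by (intro sum_nonneg integral_square_nonneg)

text \<open>Cauchy-Schwarz on \<open>{a..b}\<close>, whose length is at most \<open>w e\<close> and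
  whose share of the energy is at most the whole.\<close>

lemma edge_diff_le:
  assumes u: "pw_affine u" and e: "e < n" and ab: "0 \<le> a" "a \<le> b" "b \<le> w e"
  shows "\<bar>u (\<phi> e b) - u (\<phi> e a)\<bar> \<le> sqrt (w e) * sqrt (energy u u)"
proof (cases "a = b")
  case True
  then show ?thesis using w_pos[OF e] energy_nonneg by simp
next
  case False
  define L where "L = b - a"
  define I where "I = u (\<phi> e b) - u (\<phi> e a)"
  have L: "0 < L" "L \<le> w e" using False ab by (auto simp: L_def)
  have I: "(slope u e has_integral I) {a..b}" unfolding I_def using assms by (rule slope_has_integral)
  have sq: "(\<lambda>s. slope u e s * slope u e s) absolutely_integrable_on {0<..<w e}"
    using slope_absolutely_integrable[OF u u e] .
  have "(\<lambda>s. slope u e s * slope u e s) absolutely_integrable_on {a<..<b}"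
    by (rule set_integrable_subset[OF sq]) (use ab in auto)
  then have ab_int: "(\<lambda>s. slope u e s * slope u e s) integrable_on {a<..<b}"
    by (rule set_lebesgue_integral_eq_integral(1))
  define J where "J = integral {a..b} (\<lambda>s. slope u e s * slope u e s)"
  have J: "((\<lambda>s. slope u e s * slope u e s) has_integral J) {a..b}"
    using ab_int unfolding J_def integrable_on_open_interval_real by (rule integrable_integral)
  \<comment> \<open>The mean slope is \<open>I / L\<close>; the squared deviation from it integrates
    to \<open>J - I^2 / L\<close>, whose nonnegativity is the Cauchy-Schwarz inequality.\<close>
  have "((\<lambda>s. slope u e s * slope u e s - 2 * (I / L) * slope u e s + (I / L)^2)
      has_integral J - 2 * (I / L) * I + measure lborel {a..b} *\<^sub>R (I / L)^2) {a..b}"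
    by (intro has_integral_add has_integral_diff J has_integral_mult_right I
        has_integral_const_real[where 'a = real])
  then have "((\<lambda>s. (slope u e s - I / L)^2) has_integral J - I^2 / L) {a..b}"
    using ab L by (simp add: power2_diff power2_eq_square L_def[symmetric] field_simps)
  then have "0 \<le> J - I^2 / L" by (rule has_integral_nonneg) simp
  then have IJ: "I^2 \<le> L * J" using L by (simp add: field_simps)
  have J0: "0 \<le> J" using J by (rule has_integral_nonneg) simp
  have "J = integral {a<..<b} (\<lambda>s. slope u e s * slope u e s)"
    unfolding J_def by (simp add: integral_open_interval_real)
  also have "\<dots> \<le> integral {0<..<w e} (\<lambda>s. slope u e s * slope u e s)"
    using ab by (intro integral_subset_le ab_int set_lebesgue_integral_eq_integral(1)[OF sq]) auto
  also have "\<dots> \<le> energy u u" unfolding energy_def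
    using e member_le_sum[of e "{..<n}" "\<lambda>e. integral {0<..<w e} (\<lambda>s. slope u e s * slope u e s)"]
    by (auto simp: integral_square_nonneg)
  finally have "L * J \<le> w e * energy u u" using L J0 by (intro mult_mono) auto
  with IJ have "I^2 \<le> w e * energy u u" by simp
  then have "\<bar>I\<bar> \<le> sqrt (w e * energy u u)" by (metis real_sqrt_abs real_sqrt_le_mono)
  then show ?thesis by (simp add: real_sqrt_mult I_def)
qed

text \<open>Chain \<open>edge_diff_le\<close> along a walk from \<open>x\<close> to
  \<open>y\<close>. The constant depends on the walk and not on \<open>u\<close>, so that one
  constant serves all partial sums of the firing functions.\<close>

lemma diff_le_sqrt_energy:
  assumes "x \<in> \<Gamma>" "y \<in> \<Gamma>"
  obtains C where "0 \<le> C" "\<And>u. pw_affine u \<Longrightarrow> \<bar>u x - u y\<bar> \<le> C * sqrt (energy u u)"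
proof -
  have "\<exists>C\<ge>0. \<forall>u. pw_affine u \<longrightarrow> \<bar>u x - u y\<bar> \<le> C * sqrt (energy u u)"
    if "edge_walk n w \<phi> x y l" for x y l
    using that
  proof induction
    case (stay x)
    then show ?case by (intro exI[of _ 0]) auto
  next
    case (step e s t y l)
    then obtain C where C: "0 \<le> C"
      "\<And>u. pw_affine u \<Longrightarrow> \<bar>u (\<phi> e t) - u y\<bar> \<le> C * sqrt (energy u u)" by auto
    \<comment> \<open>Each step of the walk is charged the full \<open>sqrt (w e)\<close>, however
      short it is.\<close>
    show ?case
    proof (intro exI[of _ "sqrt (w e) + C"] conjI allI impI)
      show "0 \<le> sqrt (w e) + C" using C(1) w_pos[OF step.hyps(1)] by simp
      fix u assume u: "pw_affine u"
      have "\<bar>u (\<phi> e s) - u (\<phi> e t)\<bar> \<le> sqrt (w e) * sqrt (energy u u)"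
      proof (cases "s \<le> t")
        case True
        then show ?thesis using edge_diff_le[OF u, of e s t] step.hyps by auto
      next
        case False
        then show ?thesis using edge_diff_le[OF u, of e t s] step.hyps by auto
      qed
      then show "\<bar>u (\<phi> e s) - u y\<bar> \<le> (sqrt (w e) + C) * sqrt (energy u u)"
        using C(2)[OF u] by (simp add: algebra_simps)
    qed
  qed
  then show ?thesis using walk_exists[OF assms] that by metis
qed

end

section \<open>Firings\<close>

locale graph_firing = edge_presentation +
  fixes q :: 'a and f :: "'a firing"
  assumes firing: "firing_towards \<Gamma> q f"
begin

abbreviation "X \<equiv> fX f"
abbreviation "Y \<equiv> fY f"
abbreviation "\<epsilon> \<equiv> flen f"
abbreviation "seg \<equiv> fseg f"
abbreviation "F \<equiv> firing_fun f"

section \<open>The two sides, the segments and the values of the firing function\<close>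

lemma \<epsilon>_pos: "0 < \<epsilon>" and q_in_X: "q \<in> X" and XY_disjoint: "X \<inter> Y = {}"
  using firing unfolding firing_towards_def by auto

lemma X_subset: "X \<subseteq> \<Gamma>" and Y_subset: "Y \<subseteq> \<Gamma>"
  using firing unfolding firing_towards_def by (auto dest: closedin_imp_subset)

lemma closed_X: "closed X" and closed_Y: "closed Y"
  using firing compact_\<Gamma> unfolding firing_towards_def
  by (auto dest: closedin_closed_trans compact_imp_closed)

lemma seg_props:
  assumes "k < fnum f"
  shows "unit_speed \<epsilon> (seg k)" "seg k 0 \<in> X" "seg k \<epsilon> \<in> Y" "continuous_on {0..\<epsilon>} (seg k)"
  using firing assms unfolding firing_towards_def unit_speed_def by auto

lemma inj_seg: "inj_on (\<lambda>(k, t). seg k t) ({..<fnum f} \<times> {0<..<\<epsilon>})"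
  using firing unfolding firing_towards_def by auto

lemma cut_eq: "\<Gamma> - (X \<union> Y) = (\<Union>k<fnum f. seg k ` {0<..<\<epsilon>})"
  using firing unfolding firing_towards_def by auto

lemma seg_unique:
  assumes "k < fnum f" "t \<in> {0<..<\<epsilon>}" "k' < fnum f" "t' \<in> {0<..<\<epsilon>}" "seg k t = seg k' t'"
  shows "k = k' \<and> t = t'"
  using inj_onD[OF inj_seg, of "(k, t)" "(k', t')"] assms by auto

lemma seg_interior:
  assumes "k < fnum f" "t \<in> {0<..<\<epsilon>}"
  shows "seg k t \<in> \<Gamma>" "seg k t \<notin> X" "seg k t \<notin> Y"
proof -
  have "seg k t \<in> \<Gamma> - (X \<union> Y)" unfolding cut_eq using assms by blast
  then show "seg k t \<in> \<Gamma>" "seg k t \<notin> X" "seg k t \<notin> Y" by auto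
qed

lemma seg_cases:
  assumes "t \<in> {0..\<epsilon>}" obtains "t = 0" | "t = \<epsilon>" | "t \<in> {0<..<\<epsilon>}"
  using assms by fastforce

lemma seg_in_\<Gamma>: "k < fnum f \<Longrightarrow> t \<in> {0..\<epsilon>} \<Longrightarrow> seg k t \<in> \<Gamma>"
  using seg_cases seg_props(2,3) seg_interior(1) X_subset Y_subset by (metis subsetD)

lemma \<Gamma>_cases:
  assumes "p \<in> \<Gamma>"
  obtains "p \<in> X" | "p \<in> Y" | k t where "k < fnum f" "t \<in> {0<..<\<epsilon>}" "p = seg k t"
proof -
  have "p \<in> X \<or> p \<in> Y \<or> p \<in> (\<Union>k<fnum f. seg k ` {0<..<\<epsilon>})" using assms cut_eq by blast
  then show ?thesis using that by blast
qed

lemma fun_X: "p \<in> X \<Longrightarrow> F p = 0"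
  unfolding firing_fun_def by simp

lemma fun_Y: "p \<in> Y \<Longrightarrow> F p = \<epsilon>"
  unfolding firing_fun_def using XY_disjoint by auto

lemma fun_seg:
  assumes k: "k < fnum f" and t: "t \<in> {0..\<epsilon>}"
  shows "F (seg k t) = t"
  using t
proof (cases rule: seg_cases)
  case 3
  have "(THE r. r \<in> {0<..<\<epsilon>} \<and> (\<exists>k'<fnum f. seg k' r = seg k t)) = t"
    by (rule the_equality) (use seg_unique[OF k 3] 3 k in metis)+
  then show ?thesis using seg_interior[OF k 3] unfolding firing_fun_def by simp
qed (use seg_props[OF k] fun_X fun_Y in auto)

lemma fun_nonneg:
  assumes "p \<in> \<Gamma>" shows "0 \<le> F p"
  using assms by (cases rule: \<Gamma>_cases; use fun_X fun_Y fun_seg \<epsilon>_pos in force)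

text \<open>The preimage of a closed set is a finite union of closed sets: possibly
  \<open>X\<close>, possibly \<open>Y\<close>, and compact images of pieces of the segments.\<close>

lemma continuous_on_fun: "continuous_on \<Gamma> F"
  unfolding continuous_on_closed_vimage[OF compact_imp_closed[OF compact_\<Gamma>]]
proof (intro allI impI)
  fix B :: "real set" assume B: "closed B"
  have "F -` B \<inter> \<Gamma> = (if 0 \<in> B then X else {}) \<union> (if \<epsilon> \<in> B then Y else {}) \<union>
      (\<Union>k<fnum f. seg k ` ({0..\<epsilon>} \<inter> B))" (is "_ = ?R")
  proof (intro equalityI subsetI)
    fix p assume "p \<in> F -` B \<inter> \<Gamma>"
    then have p: "F p \<in> B" "p \<in> \<Gamma>" by auto
    show "p \<in> ?R" using p(2)
    proof (cases rule: \<Gamma>_cases)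
      case (3 k t)
      then have "t \<in> {0..\<epsilon>} \<inter> B" using p fun_seg[of k t] by auto
      then show ?thesis using 3 by blast
    qed (use p fun_X fun_Y in auto)
  next
    fix p assume "p \<in> ?R"
    then consider "0 \<in> B" "p \<in> X" | "\<epsilon> \<in> B" "p \<in> Y"
      | k t where "k < fnum f" "t \<in> {0..\<epsilon>}" "t \<in> B" "p = seg k t"
      by (auto split: if_splits)
    then show "p \<in> F -` B \<inter> \<Gamma>"
      using fun_X fun_Y fun_seg seg_in_\<Gamma> X_subset Y_subset by cases auto
  qed
  moreover have "closed (seg k ` ({0..\<epsilon>} \<inter> B))" if "k < fnum f" for k
    using B by (intro compact_imp_closed compact_continuous_image
        continuous_on_subset[OF seg_props(4)[OF that]]) auto
  ultimately show "closed (F -` B \<inter> \<Gamma>)"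
    using closed_X closed_Y by (auto intro!: closed_Un closed_UN)
qed

section \<open>The firing function is piecewise affine\<close>

definition endpoints :: "'a set" where
  "endpoints = (\<Union>k<fnum f. {seg k 0, seg k \<epsilon>})"

lemma finite_endpoints: "finite endpoints"
  unfolding endpoints_def by simp

text \<open>A point of one side that is no end of a segment lies outside the closed set formed by
  the other side and all closed segments, so a whole ball around it avoids that set.\<close>

lemma ball_subset_side:
  assumes p: "p \<in> A" "p \<notin> endpoints" and A: "A = X \<or> A = Y"
  obtains d where "0 < d" "\<And>p'. p' \<in> \<Gamma> \<Longrightarrow> dist p p' < d \<Longrightarrow> p' \<in> A"
proof -
  define B where "B = (if A = X then Y else X)"
  have AB: "A \<union> B = X \<union> Y" "A \<inter> B = {}" using A XY_disjoint by (auto simp: B_def)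
  define C where "C = B \<union> (\<Union>k<fnum f. seg k ` {0..\<epsilon>})"
  have "closed B" using closed_X closed_Y by (simp add: B_def)
  then have "closed C" unfolding C_def
    by (auto intro!: closed_UN compact_imp_closed[OF compact_continuous_image] seg_props(4))
  have "p \<notin> seg k ` {0..\<epsilon>}" if "k < fnum f" for k
  proof
    assume "p \<in> seg k ` {0..\<epsilon>}"
    then obtain t where t: "t \<in> {0..\<epsilon>}" "p = seg k t" by blast
    from t(1) show False
    proof (cases rule: seg_cases)
      case 3 then show False using seg_interior[OF that 3] p A t by auto
    qed (use p that t in \<open>auto simp: endpoints_def\<close>)
  qed
  then have "p \<in> - C" using AB p(1) unfolding C_def by auto
  then obtain d where d: "0 < d" "ball p d \<subseteq> - C"
    using \<open>closed C\<close> open_contains_ball by (metis open_Compl)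
  show ?thesis
  proof (rule that[OF d(1)])
    fix p' assume "p' \<in> \<Gamma>" "dist p p' < d"
    then have "p' \<in> \<Gamma>" "p' \<notin> C" using d(2) by auto
    then have "p' \<notin> B" "p' \<notin> (\<Union>k<fnum f. seg k ` {0<..<\<epsilon>})" unfolding C_def by fastforce+
    then show "p' \<in> A" using \<open>p' \<in> \<Gamma>\<close> cut_eq AB by blast
  qed
qed

lemma affine_near_side:
  assumes e: "e < n" and s: "s \<in> {0<..<w e}" and p: "\<phi> e s \<in> X \<union> Y" "\<phi> e s \<notin> endpoints"
  shows "affine_near (\<lambda>r. F (\<phi> e r)) s 0"
proof -
  obtain A where A: "\<phi> e s \<in> A" "A = X \<or> A = Y" using p(1) by blast
  obtain d where d: "0 < d" "\<And>p'. p' \<in> \<Gamma> \<Longrightarrow> dist (\<phi> e s) p' < d \<Longrightarrow> p' \<in> A"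
    using ball_subset_side[OF A(1) p(2) A(2)] by metis
  show ?thesis
  proof (rule affine_nearI[of "min d (min s (w e - s))"])
    fix u :: real assume u: "\<bar>u\<bar> < min d (min s (w e - s))"
    then have su: "s + u \<in> {0..w e}" by auto
    have "dist (\<phi> e s) (\<phi> e (s + u)) < d" using dist_edge_le[OF e _ su, of s] s u by auto
    then have "\<phi> e (s + u) \<in> A" using d(2) edge_in_\<Gamma>[OF e su] by blast
    then show "F (\<phi> e (s + u)) = F (\<phi> e s) + 0 * u"
      using A fun_X fun_Y by auto
  qed (use d s in auto)
qed

text \<open>On a segment the firing function is the time. The segment follows the edge in direction
  \<open>\<sigma>\<close>, so along the edge the firing function has slope
  \<open>1 / \<sigma>\<close>, which is \<open>\<sigma>\<close>.\<close>

lemma seg_along_edge: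
  assumes k: "k < fnum f" and t: "t \<in> {0<..<\<epsilon>}" and e: "e < n" and s: "s \<in> {0<..<w e}"
    and eq: "seg k t = \<phi> e s"
  obtains \<sigma> \<delta> :: real where "\<bar>\<sigma>\<bar> = 1" "0 < \<delta>" "affine_near (\<lambda>r. F (\<phi> e r)) s \<sigma>"
    "\<And>u. \<bar>u\<bar> < \<delta> \<Longrightarrow> t + u \<in> {0<..<\<epsilon>} \<and> s + \<sigma> * u \<in> {0<..<w e} \<and> seg k (t + u) = \<phi> e (s + \<sigma> * u)"
proof -
  have "seg k ` {0<..<\<epsilon>} \<subseteq> \<Gamma>" using seg_interior[OF k] by auto
  then obtain \<sigma> \<delta> :: real where *: "\<sigma> = 1 \<or> \<sigma> = -1" "0 < \<delta>"
    "\<And>u. \<bar>u\<bar> < \<delta> \<Longrightarrow> t + u \<in> {0<..<\<epsilon>} \<and> s + \<sigma> * u \<in> {0<..<w e} \<and> seg k (t + u) = \<phi> e (s + \<sigma> * u)"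
    using unit_speed_along_edge[OF e s seg_props(1)[OF k] _ t eq] by metis
  have \<sigma>: "\<sigma> * \<sigma> = 1" "\<bar>\<sigma>\<bar> = 1" using *(1) by auto
  have "affine_near (\<lambda>r. F (\<phi> e r)) s \<sigma>"
  proof (rule affine_nearI[OF *(2)])
    fix u assume "\<bar>u\<bar> < \<delta>"
    \<comment> \<open>As \<open>\<sigma> * \<sigma> = 1\<close>, the displacement \<open>u\<close>
      on the edge is reached at time \<open>t + \<sigma> * u\<close>.\<close>
    then have "t + \<sigma> * u \<in> {0<..<\<epsilon>}" "seg k (t + \<sigma> * u) = \<phi> e (s + \<sigma> * (\<sigma> * u))"
      using *(3)[of "\<sigma> * u"] \<sigma>(2) by (auto simp: abs_mult)
    moreover have "\<sigma> * (\<sigma> * u) = u" using \<sigma>(1) by (metis mult.assoc mult_1)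
    ultimately show "F (\<phi> e (s + u)) = F (\<phi> e s) + \<sigma> * u"
      using fun_seg[OF k, of "t + \<sigma> * u"] fun_seg[OF k, of t] t eq by auto
  qed
  then show ?thesis using that[OF \<sigma>(2) *(2)] *(3) by blast
qed

lemma finite_edge_preimage:
  assumes "finite P" shows "finite (\<Union>e<n. {s \<in> {0<..<w e}. \<phi> e s \<in> P})"
proof -
  have "finite {s \<in> {0<..<w e}. \<phi> e s \<in> P}" if "e < n" for e
    using finite_vimage_IntI[OF assms inj_on_edge[OF that]]
    by (rule finite_subset[rotated]) auto
  then show ?thesis by auto
qed

text \<open>Slopes are 0 on the sides and 1 or -1 on the segments; only \<open>endpoints\<close> can
  be breakpoints inside an edge.\<close>

lemma pw_affine_fun: "pw_affine F"
  unfolding pw_affine_def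
proof (rule conjI[OF continuous_on_fun])
  let ?S = "\<Union>e<n. {s \<in> {0<..<w e}. \<phi> e s \<in> endpoints}"
  have "\<exists>c. \<bar>c\<bar> \<le> 1 \<and> affine_near (\<lambda>r. F (\<phi> e r)) s c"
    if e: "e < n" and s: "s \<in> {0<..<w e} - ?S" for e s
  proof -
    have s': "s \<in> {0<..<w e}" and nP: "\<phi> e s \<notin> endpoints" using s e by auto
    have "\<phi> e s \<in> \<Gamma>" using edge_in_\<Gamma>[OF e] s' by auto
    then show ?thesis
    proof (cases rule: \<Gamma>_cases)
      case (3 k t)
      then show ?thesis using seg_along_edge[OF 3(1,2) e s'] by (metis order_refl)
    qed (use affine_near_side[OF e s' _ nP] in \<open>auto intro!: exI[of _ 0]\<close>)
  qed
  then show "\<exists>S K. finite S \<and>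
      (\<forall>e<n. \<forall>s\<in>{0<..<w e} - S. \<exists>c. \<bar>c\<bar> \<le> K \<and> affine_near (\<lambda>r. F (\<phi> e r)) s c)"
    using finite_edge_preimage[OF finite_endpoints] by blast
qed

text \<open>A segment may pass through points of \<open>V\<close>, hence through several edges, and
  may return to an edge that it has left. It is therefore split into the times spent inside each
  edge, with \<open>seg_param\<close> as edge coordinate.\<close>

definition seg_dom :: "nat \<Rightarrow> nat \<Rightarrow> real set" where
  "seg_dom k e = {t \<in> {0<..<\<epsilon>}. seg k t \<in> \<phi> e ` {0<..<w e}}"

definition seg_param :: "nat \<Rightarrow> nat \<Rightarrow> real \<Rightarrow> real" where
  "seg_param k e t = the_inv_into {0<..<w e} (\<phi> e) (seg k t)"

lemma seg_param:
  assumes "e < n" "t \<in> seg_dom k e"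
  shows "seg_param k e t \<in> {0<..<w e}" "\<phi> e (seg_param k e t) = seg k t"
  using assms the_inv_into_into[OF inj_on_edge[OF assms(1)] _ order_refl, of "seg k t"]
    f_the_inv_into_f[OF inj_on_edge[OF assms(1)], of "seg k t"]
  unfolding seg_dom_def seg_param_def by auto

lemma seg_param_eqI:
  assumes "e < n" "s \<in> {0<..<w e}" "seg k t = \<phi> e s"
  shows "seg_param k e t = s"
  using the_inv_into_f_f[OF inj_on_edge[OF assms(1)] assms(2)] assms(3)
  unfolding seg_param_def by simp

text \<open>The slope of the firing function is the direction in which the segment follows the edge,
  so it is also the speed of the edge coordinate.\<close>

lemma seg_param_local:
  assumes k: "k < fnum f" and e: "e < n" and t: "t \<in> seg_dom k e"
  obtains \<delta> where "0 < \<delta>" "\<bar>slope F e (seg_param k e t)\<bar> = 1"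
    "\<And>u. \<bar>u\<bar> < \<delta> \<Longrightarrow> t + u \<in> seg_dom k e \<and>
       seg_param k e (t + u) = seg_param k e t + slope F e (seg_param k e t) * u"
proof -
  have t': "t \<in> {0<..<\<epsilon>}" using t unfolding seg_dom_def by auto
  note s = seg_param[OF e t]
  obtain \<sigma> \<delta> :: real where *: "\<bar>\<sigma>\<bar> = 1" "0 < \<delta>"
    "affine_near (\<lambda>r. F (\<phi> e r)) (seg_param k e t) \<sigma>"
    "\<And>u. \<bar>u\<bar> < \<delta> \<Longrightarrow> t + u \<in> {0<..<\<epsilon>} \<and> seg_param k e t + \<sigma> * u \<in> {0<..<w e} \<and>
      seg k (t + u) = \<phi> e (seg_param k e t + \<sigma> * u)"
    using seg_along_edge[OF k t' e s(1) s(2)[symmetric]] by metis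
  have sl: "slope F e (seg_param k e t) = \<sigma>" using slope_eqI[OF *(3)] .
  show ?thesis
  proof (rule that[OF *(2)])
    fix u :: real assume u: "\<bar>u\<bar> < \<delta>"
    then show "t + u \<in> seg_dom k e \<and>
       seg_param k e (t + u) = seg_param k e t + slope F e (seg_param k e t) * u"
      using *(4)[OF u] seg_param_eqI[OF e] unfolding sl seg_dom_def by auto
  qed (use * sl in auto)
qed

lemma open_seg_dom:
  assumes "k < fnum f" "e < n" shows "open (seg_dom k e)"
  unfolding open_dist
proof (intro ballI)
  fix t assume "t \<in> seg_dom k e"
  then obtain \<delta> where \<delta>: "0 < \<delta>" "\<And>u. \<bar>u\<bar> < \<delta> \<Longrightarrow> t + u \<in> seg_dom k e"
    using seg_param_local[OF assms] by metis
  show "\<exists>d>0. \<forall>r. dist r t < d \<longrightarrow> r \<in> seg_dom k e"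
    using \<delta>(1) \<delta>(2)[of "r - t" for r] by (auto simp: dist_real_def)
qed

text \<open>Locally the map is \<open>s + \<sigma> * u\<close> with \<open>\<sigma>\<close> equal to
  1 or -1, so the image contains an interval around \<open>s\<close>. Openness supplies the
  measurability for the change of variables.\<close>

lemma open_seg_param_image:
  assumes k: "k < fnum f" and e: "e < n" shows "open (seg_param k e ` seg_dom k e)"
  unfolding open_dist
proof (intro ballI)
  fix s assume "s \<in> seg_param k e ` seg_dom k e"
  then obtain t where t: "t \<in> seg_dom k e" "s = seg_param k e t" by blast
  let ?\<sigma> = "slope F e s"
  obtain \<delta> where \<delta>: "0 < \<delta>" "\<bar>?\<sigma>\<bar> = 1"
    "\<And>u. \<bar>u\<bar> < \<delta> \<Longrightarrow> t + u \<in> seg_dom k e \<and> seg_param k e (t + u) = s + ?\<sigma> * u"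
    using seg_param_local[OF k e t(1)] unfolding t(2) by metis
  have "r \<in> seg_param k e ` seg_dom k e" if "dist r s < \<delta>" for r
  proof -
    have "\<bar>?\<sigma> * (r - s)\<bar> < \<delta>" using that \<delta>(2) by (simp add: abs_mult dist_real_def)
    from \<delta>(3)[OF this] have "t + ?\<sigma> * (r - s) \<in> seg_dom k e"
      "seg_param k e (t + ?\<sigma> * (r - s)) = s + ?\<sigma> * (?\<sigma> * (r - s))" by auto
    moreover have "?\<sigma> * (?\<sigma> * (r - s)) = r - s"
      using \<delta>(2) by (auto simp: abs_if split: if_splits)
    ultimately show ?thesis by (metis add.commute diff_add_cancel image_eqI)
  qed
  then show "\<exists>d>0. \<forall>r. dist r s < d \<longrightarrow> r \<in> seg_param k e ` seg_dom k e" using \<delta>(1) by blast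
qed

lemma inj_on_seg_param:
  assumes "k < fnum f" "e < n" shows "inj_on (seg_param k e) (seg_dom k e)"
proof (rule inj_onI)
  fix t t' assume *: "t \<in> seg_dom k e" "t' \<in> seg_dom k e" "seg_param k e t = seg_param k e t'"
  then have "seg k t = seg k t'" using seg_param(2)[OF assms(2)] by metis
  then show "t = t'" using seg_unique assms(1) * unfolding seg_dom_def by blast
qed

text \<open>The Jacobian is the slope of the firing function, of absolute value 1, so substitution
  leaves the integrand as it is.\<close>

lemma seg_param_change_of_variables:
  assumes k: "k < fnum f" and e: "e < n" and u: "pw_affine u"
  shows "((\<lambda>t. slope F e (seg_param k e t) * slope u e (seg_param k e t)) has_integral
      integral (seg_param k e ` seg_dom k e) (\<lambda>s. slope F e s * slope u e s)) (seg_dom k e)"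
    and "(\<lambda>s. slope F e s * slope u e s) integrable_on seg_param k e ` seg_dom k e"
proof -
  let ?A = "seg_dom k e" and ?\<theta> = "seg_param k e" and ?H = "\<lambda>s. slope F e s * slope u e s"
  let ?g = "\<lambda>t. slope F e (?\<theta> t)"
  have A: "?A \<in> sets lebesgue" using open_seg_dom[OF k e] by (simp add: sets_completionI_sets)
  have B: "?\<theta> ` ?A \<in> sets lebesgue"
    using open_seg_param_image[OF k e] by (simp add: sets_completionI_sets)
  have g: "\<bar>?g t\<bar> = 1" if "t \<in> ?A" for t using seg_param_local[OF k e that] by metis
  have der: "(?\<theta> has_field_derivative ?g t) (at t within ?A)" if t: "t \<in> ?A" for t
  proof -
    have "affine_near ?\<theta> t (?g t)" using seg_param_local[OF k e t] affine_nearI by metis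
    then show ?thesis using affine_near_DERIV has_field_derivative_at_within by blast
  qed
  have "?H absolutely_integrable_on {0<..<w e}"
    using slope_absolutely_integrable[OF pw_affine_fun u e] .
  then have H: "?H absolutely_integrable_on ?\<theta> ` ?A"
    by (rule set_integrable_subset[OF _ B]) (use seg_param[OF e] in auto)
  then show "?H integrable_on ?\<theta> ` ?A" by (rule set_lebesgue_integral_eq_integral(1))
  have *: "(\<lambda>t. \<bar>?g t\<bar> * ?H (?\<theta> t)) absolutely_integrable_on ?A \<and>
      integral ?A (\<lambda>t. \<bar>?g t\<bar> * ?H (?\<theta> t)) = integral (?\<theta> ` ?A) ?H"
    using has_absolute_integral_change_of_variables_1'[OF A der inj_on_seg_param[OF k e],
        of ?H "integral (?\<theta> ` ?A) ?H"] H by blast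
  then have "((\<lambda>t. \<bar>?g t\<bar> * ?H (?\<theta> t)) has_integral integral (?\<theta> ` ?A) ?H) ?A"
    using integrable_integral[OF set_lebesgue_integral_eq_integral(1)[OF conjunct1[OF *]]]
      conjunct2[OF *] by simp
  then show "((\<lambda>t. ?H (?\<theta> t)) has_integral integral (?\<theta> ` ?A) ?H) ?A"
    by (rule has_integral_eq[rotated]) (use g in auto)
qed

text \<open>By the chain rule, the derivative of \<open>u\<close> along the segment is the product
  of the slopes of \<open>F\<close> and \<open>u\<close> at the point reached. The fundamental
  theorem of calculus gives the left side, a change of variables on each edge the right
  side.\<close>

lemma energy_along_seg:
  assumes k: "k < fnum f" and u: "pw_affine u"
  shows "u (seg k \<epsilon>) - u (seg k 0) =
    (\<Sum>e<n. integral (seg_param k e ` seg_dom k e) (\<lambda>s. slope F e s * slope u e s))"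
proof -
  \<comment> \<open>Extension by zero puts the contributions of all edges on the common interval
    \<open>{0..\<epsilon>}\<close>.\<close>
  define h where "h e t = (if t \<in> seg_dom k e
    then slope F e (seg_param k e t) * slope u e (seg_param k e t) else 0)" for e t
  have sub: "seg_dom k e \<subseteq> {0..\<epsilon>}" for e unfolding seg_dom_def by auto
  have "(h e has_integral integral (seg_param k e ` seg_dom k e) (\<lambda>s. slope F e s * slope u e s))
      {0..\<epsilon>}" if "e < n" for e
    unfolding h_def has_integral_restrict[OF sub]
    using seg_param_change_of_variables(1)[OF k that u] .
  then have 1: "((\<lambda>t. \<Sum>e<n. h e t) has_integral
      (\<Sum>e<n. integral (seg_param k e ` seg_dom k e) (\<lambda>s. slope F e s * slope u e s))) {0..\<epsilon>}"
    by (intro has_integral_sum) auto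
  from u obtain S where S: "finite S"
    "\<And>e s. e < n \<Longrightarrow> s \<in> {0<..<w e} - S \<Longrightarrow> affine_near (\<lambda>r. u (\<phi> e r)) s (slope u e s)"
    by (rule pw_affineE) blast
  \<comment> \<open>Contains all times at which the segment meets a vertex or a breakpoint of
    \<open>u\<close>; finite because the segment is injective.\<close>
  define T where "T = {t \<in> {0<..<\<epsilon>}. seg k t \<in> V \<union> (\<Union>e<n. \<phi> e ` S)}"
  have "inj_on (seg k) {0<..<\<epsilon>}" using seg_unique[OF k _ k] by (auto intro: inj_onI)
  then have "finite (seg k -` (V \<union> (\<Union>e<n. \<phi> e ` S)) \<inter> {0<..<\<epsilon>})"
    using S(1) finite_V by (intro finite_vimage_IntI) auto
  then have T: "finite T" unfolding T_def by (rule finite_subset[rotated]) auto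
  have 2: "((\<lambda>t. \<Sum>e<n. h e t) has_integral (u (seg k \<epsilon>) - u (seg k 0))) {0..\<epsilon>}"
  proof (rule fundamental_theorem_of_calculus_interior_strong[OF T])
    show "continuous_on {0..\<epsilon>} (\<lambda>t. u (seg k t))"
      using u seg_in_\<Gamma>[OF k] unfolding pw_affine_def
      by (intro continuous_on_compose2[OF _ seg_props(4)[OF k]]) auto
  next
    fix t assume t: "t \<in> {0<..<\<epsilon>} - T"
    then have "seg k t \<in> \<Gamma>" "seg k t \<notin> V" "\<And>e. e < n \<Longrightarrow> seg k t \<notin> \<phi> e ` S"
      using seg_interior(1)[OF k, of t] unfolding T_def by auto
    then obtain e s where es: "e < n" "s \<in> {0..w e}" "seg k t = \<phi> e s" "s \<notin> S"
      unfolding \<Gamma>_eq by blast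
    then have s: "s \<in> {0<..<w e}" using ends_in_V \<open>seg k t \<notin> V\<close>
      by (metis atLeastAtMost_iff greaterThanLessThan_iff less_eq_real_def)
    have t_dom: "t \<in> seg_dom k e" using t s es unfolding seg_dom_def by auto
    have s_eq: "seg_param k e t = s" by (rule seg_param_eqI[OF es(1) s es(3)])
    \<comment> \<open>Off \<open>V\<close> a point lies inside exactly one edge, so a single summand
      survives.\<close>
    have "h e' t = 0" if "e' < n" "e' \<noteq> e" for e'
    proof -
      have "\<phi> e s \<noteq> \<phi> e' s'" if "s' \<in> {0<..<w e'}" for s'
        using that interior_unique[OF es(1) s \<open>e' < n\<close>, of s'] \<open>e' \<noteq> e\<close> by auto
      then have "\<phi> e s \<notin> \<phi> e' ` {0<..<w e'}" by blast
      then have "t \<notin> seg_dom k e'" using es(3) unfolding seg_dom_def by simp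
      then show ?thesis unfolding h_def by simp
    qed
    then have "(\<Sum>e<n. h e t) = (\<Sum>e'<n. if e' = e then h e t else 0)"
      by (intro sum.cong) auto
    also have "\<dots> = h e t" using es(1) by simp
    also have "\<dots> = slope F e s * slope u e s" unfolding h_def using t_dom s_eq by simp
    finally have sum: "(\<Sum>e<n. h e t) = slope F e s * slope u e s" .
    obtain \<delta> where \<delta>: "0 < \<delta>" "\<bar>slope F e s\<bar> = 1"
      "\<And>v. \<bar>v\<bar> < \<delta> \<Longrightarrow> t + v \<in> seg_dom k e \<and> seg_param k e (t + v) = s + slope F e s * v"
      using seg_param_local[OF k es(1) t_dom] unfolding s_eq by metis
    obtain d where d: "0 < d" "\<And>r. dist r s < d \<Longrightarrow> u (\<phi> e r) = u (\<phi> e s) + slope u e s * (r - s)"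
      using S(2)[OF es(1), of s] s es(4) unfolding affine_near_def eventually_nhds_metric by auto
    have "affine_near (\<lambda>t. u (seg k t)) t (slope F e s * slope u e s)"
    proof (rule affine_nearI[of "min d \<delta>"])
      fix v assume v: "\<bar>v\<bar> < min d \<delta>"
      then have "seg k (t + v) = \<phi> e (s + slope F e s * v)"
        using \<delta>(3)[of v] seg_param(2)[OF es(1), of "t + v" k] by auto
      moreover have "dist (s + slope F e s * v) s < d"
        using v \<delta>(2) by (simp add: dist_real_def abs_mult)
      ultimately show "u (seg k (t + v)) = u (seg k t) + slope F e s * slope u e s * v"
        using d(2) es(3) by simp
    qed (use d \<delta> in auto)
    then show "((\<lambda>t. u (seg k t)) has_vector_derivative (\<Sum>e<n. h e t)) (at t)"
      unfolding sum using affine_near_DERIV has_real_derivative_iff_has_vector_derivative by blast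
  qed (use \<epsilon>_pos in auto)
  show ?thesis using has_integral_unique[OF 2 1] .
qed

text \<open>The identity E(f, u) = <Q(f), u>. The firing function is locally constant on the sides,
  so only the segments contribute, and the sums over edges and segments are exchanged.\<close>

lemma energy_firing:
  assumes u: "pw_affine u"
  shows "energy F u = (\<Sum>k<fnum f. u (seg k \<epsilon>) - u (seg k 0))"
proof -
  have "integral {0<..<w e} (\<lambda>s. slope F e s * slope u e s) =
      (\<Sum>k<fnum f. integral (seg_param k e ` seg_dom k e) (\<lambda>s. slope F e s * slope u e s))"
    if e: "e < n" for e
  proof -
    let ?H = "\<lambda>s. slope F e s * slope u e s" and ?B = "\<lambda>k. seg_param k e ` seg_dom k e"
    let ?P = "\<Union>e<n. {s \<in> {0<..<w e}. \<phi> e s \<in> endpoints}"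
    have sub: "?B k \<subseteq> {0<..<w e}" for k using seg_param(1)[OF e] by auto
    have B_iff: "s \<in> ?B k \<longleftrightarrow> \<phi> e s \<in> seg k ` {0<..<\<epsilon>}" if "s \<in> {0<..<w e}" "k < fnum f" for s k
    proof
      assume "s \<in> ?B k"
      then show "\<phi> e s \<in> seg k ` {0<..<\<epsilon>}" using seg_param(2)[OF e] by (force simp: seg_dom_def)
    next
      assume "\<phi> e s \<in> seg k ` {0<..<\<epsilon>}"
      then obtain t where t: "t \<in> {0<..<\<epsilon>}" "seg k t = \<phi> e s" by force
      then have "t \<in> seg_dom k e" using that by (auto simp: seg_dom_def)
      then show "s \<in> ?B k" using seg_param_eqI[OF e that(1) t(2)] by force
    qed
    have "((\<lambda>s. if s \<in> ?B k then ?H s else 0) has_integral integral (?B k) ?H) {0<..<w e}"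
      if "k < fnum f" for k
      unfolding has_integral_restrict[OF sub]
      using seg_param_change_of_variables(2)[OF that e u] by (rule integrable_integral)
    then have int: "((\<lambda>s. \<Sum>k<fnum f. if s \<in> ?B k then ?H s else 0) has_integral
        (\<Sum>k<fnum f. integral (?B k) ?H)) {0<..<w e}"
      by (intro has_integral_sum) auto
    \<comment> \<open>Off the finite set \<open>?P\<close>, either the slope of \<open>F\<close>
      vanishes or the point lies on exactly one segment.\<close>
    have eq: "?H s = (\<Sum>k<fnum f. if s \<in> ?B k then ?H s else 0)"
      if s: "s \<in> {0<..<w e} - ?P" for s
    proof -
      have s': "s \<in> {0<..<w e}" "\<phi> e s \<notin> endpoints" using s e by auto
      have "\<phi> e s \<in> \<Gamma>" using edge_in_\<Gamma>[OF e] s' by auto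
      then show ?thesis
      proof (cases "\<phi> e s \<in> X \<union> Y")
        case True
        then have "slope F e s = 0" using slope_eqI[OF affine_near_side[OF e s'(1) _ s'(2)]] by blast
        then have "?H s = 0" by simp
        then show ?thesis by (intro trans[OF _ sum.neutral[symmetric]]) auto
      next
        case False
        then obtain k t where kt: "k < fnum f" "t \<in> {0<..<\<epsilon>}" "\<phi> e s = seg k t"
          using \<open>\<phi> e s \<in> \<Gamma>\<close> \<Gamma>_cases by blast
        have "s \<in> ?B k' \<longleftrightarrow> k' = k" if "k' < fnum f" for k'
          unfolding B_iff[OF s'(1) that] using kt seg_unique[OF kt(1,2) that] by auto
        then have "(\<Sum>k'<fnum f. if s \<in> ?B k' then ?H s else 0) =
            (\<Sum>k'<fnum f. if k' = k then ?H s else 0)" by (intro sum.cong) auto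
        then show ?thesis using kt(1) by simp
      qed
    qed
    have "(?H has_integral (\<Sum>k<fnum f. integral (?B k) ?H)) {0<..<w e}"
      by (rule has_integral_spike_finite[OF finite_edge_preimage[OF finite_endpoints] eq int])
    then show ?thesis by (rule integral_unique)
  qed
  then have "energy F u = (\<Sum>e<n. \<Sum>k<fnum f. integral (seg_param k e ` seg_dom k e)
      (\<lambda>s. slope F e s * slope u e s))"
    unfolding energy_def by simp
  also have "\<dots> = (\<Sum>k<fnum f. u (seg k \<epsilon>) - u (seg k 0))"
    by (subst sum.swap) (simp add: energy_along_seg[OF _ u])
  finally show ?thesis .
qed

text \<open>\<open>unit_speed\<close> gives distances only locally and on the open interval: the
  local bounds are joined by the bisection principle \<open>Bolzano\<close>, then carried to the
  ends by continuity.\<close>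

lemma dist_seg_le:
  assumes k: "k < fnum f" shows "dist (seg k \<epsilon>) (seg k 0) \<le> \<epsilon>"
proof -
  have loc: "dist (seg k a) (seg k b) \<le> b - a" if "0 < a" "a \<le> b" "b < \<epsilon>" for a b
  proof -
    have "0 < a \<and> b < \<epsilon> \<longrightarrow> dist (seg k a) (seg k b) \<le> b - a" using that(2)
    proof (induction rule: Bolzano)
      case (trans a b c)
      then show ?case using dist_triangle[of "seg k a" "seg k c" "seg k b"] by force
    next
      case (local x)
      show ?case
      proof (cases "x \<in> {0<..<\<epsilon>}")
        case True
        then obtain d where d: "0 < d" "\<And>s s'. s \<in> {0<..<\<epsilon>} \<inter> ball x d \<Longrightarrow>
            s' \<in> {0<..<\<epsilon>} \<inter> ball x d \<Longrightarrow> dist (seg k s) (seg k s') = \<bar>s - s'\<bar>"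
          using seg_props(1)[OF k] unfolding unit_speed_def by metis
        then show ?thesis by (intro exI[of _ d]) (auto simp: dist_real_def)
      next
        case False
        \<comment> \<open>No subinterval of \<open>{0<..<\<epsilon>}\<close> contains this
          \<open>x\<close>, so any radius will do.\<close>
        then show ?thesis by (intro exI[of _ 1]) auto
      qed
    qed
    then show ?thesis using that by blast
  qed
  have "dist (seg k b) (seg k a) \<le> \<epsilon>" if "a \<in> {0<..<\<epsilon>}" "b \<in> {0<..<\<epsilon>}" for a b
    using loc[of a b] loc[of b a] that by (cases "a \<le> b") (auto simp: dist_commute)
  \<comment> \<open>As a function of both times, the distance obeys the bound on the closure of the
    open square, which contains \<open>(0, \<epsilon>)\<close>.\<close>
  moreover have "continuous_on ({0..\<epsilon>} \<times> {0..\<epsilon>}) (\<lambda>z. dist (seg k (snd z)) (seg k (fst z)))"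
    by (intro continuous_intros continuous_on_compose2[OF seg_props(4)[OF k]]) auto
  moreover have "{0..\<epsilon>} \<times> {0..\<epsilon>} = closure ({0<..<\<epsilon>} \<times> {0<..<\<epsilon>})"
    using \<epsilon>_pos by (simp add: closure_Times closure_greaterThanLessThan)
  ultimately show ?thesis
    using continuous_le_on_closure[of "{0<..<\<epsilon>} \<times> {0<..<\<epsilon>}"
        "\<lambda>z. dist (seg k (snd z)) (seg k (fst z))" "(0, \<epsilon>)" \<epsilon>] \<epsilon>_pos by fastforce
qed

end

section \<open>Divisors and legal reductions\<close>

definition div_pairing :: "('a \<Rightarrow>\<^sub>0 int) \<Rightarrow> ('a \<Rightarrow> real) \<Rightarrow> real" where
  "div_pairing D u = (\<Sum>p\<in>Poly_Mapping.keys D. of_int (Poly_Mapping.lookup D p) * u p)"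

lemma div_pairing_superset:
  "finite A \<Longrightarrow> Poly_Mapping.keys D \<subseteq> A \<Longrightarrow>
   div_pairing D u = (\<Sum>p\<in>A. of_int (Poly_Mapping.lookup D p) * u p)"
  unfolding div_pairing_def by (intro sum.mono_neutral_left) (auto simp: in_keys_iff)

lemma div_pairing_zero [simp]: "div_pairing 0 u = 0"
  by (simp add: div_pairing_def)

lemma div_pairing_frag_of [simp]: "div_pairing (frag_of p) u = u p"
  by (simp add: div_pairing_def)

lemma div_pairing_add: "div_pairing (D + D') u = div_pairing D u + div_pairing D' u"
proof -
  let ?A = "Poly_Mapping.keys D \<union> Poly_Mapping.keys D'"
  have "Poly_Mapping.keys (D + D') \<subseteq> ?A" by (rule Poly_Mapping.keys_add)
  then show ?thesis
    using div_pairing_superset[of ?A] by (simp add: lookup_add distrib_right sum.distrib)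
qed

lemma div_pairing_diff: "div_pairing (D - D') u = div_pairing D u - div_pairing D' u"
  using div_pairing_add[of "D - D'" D' u] by simp

lemma div_pairing_sum:
  fixes k :: nat
  shows "div_pairing (\<Sum>i<k. D i) u = (\<Sum>i<k. div_pairing (D i) u)"
  by (induction k) (simp_all add: div_pairing_add)

lemma div_pairing_fun_sum: "div_pairing D (\<lambda>p. \<Sum>i\<in>I. u i p) = (\<Sum>i\<in>I. div_pairing D (u i))"
  unfolding div_pairing_def sum_distrib_left by (rule sum.swap)

lemma div_pairing_firing_div:
  "div_pairing (firing_div f) u = (\<Sum>k<fnum f. u (fseg f k (flen f)) - u (fseg f k 0))"
  unfolding firing_div_def by (simp add: div_pairing_sum div_pairing_diff)

section \<open>Effective divisors as numbered chips\<close>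

lemma effective_eq_sum_frag_of:
  assumes "\<And>p. 0 \<le> Poly_Mapping.lookup E p"
  obtains m :: nat and x where "E = (\<Sum>j<m. frag_of (x j))" "\<And>j. j < m \<Longrightarrow> x j \<in> Poly_Mapping.keys E"
proof -
  have rep: "sum_list (map frag_of (replicate k p)) = frag_cmul (int k) (frag_of p)" for k p
    by (induction k) (simp_all add: frag_cmul_distrib)
  have "\<exists>xs. set xs \<subseteq> A \<and> (\<Sum>p\<in>A. frag_cmul (Poly_Mapping.lookup E p) (frag_of p)) =
      sum_list (map frag_of xs)" if "finite A" for A
    using that
  proof induction
    case empty
    then show ?case by (intro exI[of _ "[]"]) simp
  next
    case (insert p A)
    then obtain xs where xs: "set xs \<subseteq> A"
      "(\<Sum>p\<in>A. frag_cmul (Poly_Mapping.lookup E p) (frag_of p)) = sum_list (map frag_of xs)"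
      by blast
    \<comment> \<open>Each point is listed as often as its coefficient says.\<close>
    show ?case
      using xs insert.hyps assms[of p] rep[of "nat (Poly_Mapping.lookup E p)" p]
      by (intro exI[of _ "replicate (nat (Poly_Mapping.lookup E p)) p @ xs"]) auto
  qed
  then obtain xs where xs: "set xs \<subseteq> Poly_Mapping.keys E"
    "(\<Sum>p\<in>Poly_Mapping.keys E. frag_cmul (Poly_Mapping.lookup E p) (frag_of p)) =
      sum_list (map frag_of xs)"
    using finite_keys by metis
  have "E = sum_list (map frag_of xs)"
    using frag_expansion[of E] xs(2) unfolding frag_extend_def by simp
  also have "\<dots> = (\<Sum>j<length xs. frag_of (xs ! j))"
    by (simp add: sum_list_sum_nth atLeast0LessThan)
  finally show ?thesis using that[of "nth xs" "length xs"] xs(1) nth_mem by blast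
qed

text \<open>The chips are moved one pair at a time. No \<open>z\<close> is a \<open>y\<close>, so at
  \<open>z K\<close> the earlier moves can only have added chips; hence dropping the last move
  leaves an effective divisor, which then has a chip at \<open>y K\<close>.\<close>

lemma move_chips:
  fixes x y z :: "nat \<Rightarrow> 'a::metric_space" and m K :: nat
  assumes "\<And>p. 0 \<le> Poly_Mapping.lookup ((\<Sum>j<m. frag_of (x j)) - (\<Sum>k<K. frag_of (y k) - frag_of (z k))) p"
    and "\<And>k l. k < K \<Longrightarrow> l < K \<Longrightarrow> y k \<noteq> z l"
  shows "\<exists>x'. (\<Sum>j<m. frag_of (x' j)) =
        (\<Sum>j<m. frag_of (x j)) - (\<Sum>k<K. frag_of (y k) - frag_of (z k)) \<and>
      (\<forall>j<m. x' j \<in> x ` {..<m} \<union> z ` {..<K}) \<and>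
      (\<Sum>j<m. dist (x j) (x' j)) \<le> (\<Sum>k<K. dist (y k) (z k))"
  using assms
proof (induction K)
  case 0
  then show ?case by (intro exI[of _ x]) auto
next
  case (Suc K)
  let ?E = "\<lambda>K. (\<Sum>j<m. frag_of (x j)) - (\<Sum>k<K. frag_of (y k) - frag_of (z k))"
  have step: "?E K = ?E (Suc K) + frag_of (y K) - frag_of (z K)" by simp
  have "0 \<le> Poly_Mapping.lookup (?E K) p" for p
  proof (cases "p = z K")
    case False
    have "0 \<le> Poly_Mapping.lookup (?E (Suc K)) p" by (rule Suc.prems(1))
    then show ?thesis using False unfolding step by (simp add: lookup_add lookup_minus split: if_splits)
  next
    case True
    have "Poly_Mapping.lookup (frag_of (y k) - frag_of (z k)) (z K) \<le> 0" if "k < K" for k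
      using Suc.prems(2)[of k K] that by (simp add: lookup_minus)
    then have "(\<Sum>k<K. Poly_Mapping.lookup (frag_of (y k) - frag_of (z k)) (z K)) \<le> 0"
      by (intro sum_nonpos) auto
    moreover have "0 \<le> (\<Sum>j<m. Poly_Mapping.lookup (frag_of (x j)) (z K))"
      by (intro sum_nonneg) simp
    ultimately show ?thesis unfolding True lookup_minus lookup_sum by linarith
  qed
  then obtain x' where x': "(\<Sum>j<m. frag_of (x' j)) = ?E K"
    "\<And>j. j < m \<Longrightarrow> x' j \<in> x ` {..<m} \<union> z ` {..<K}"
    "(\<Sum>j<m. dist (x j) (x' j)) \<le> (\<Sum>k<K. dist (y k) (z k))"
    using Suc.IH[OF _ Suc.prems(2)] by (meson less_SucI)
  have "0 \<le> Poly_Mapping.lookup (?E (Suc K)) (y K)" by (rule Suc.prems(1))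
  then have "0 < Poly_Mapping.lookup (?E K) (y K)"
    unfolding step using Suc.prems(2)[of K K] by (simp add: lookup_add lookup_minus)
  then have "(\<Sum>j<m. Poly_Mapping.lookup (frag_of (x' j)) (y K)) \<noteq> 0"
    unfolding x'(1)[symmetric] lookup_sum by simp
  then obtain j where j: "j < m" "x' j = y K"
    by (metis (no_types, lifting) lessThan_iff lookup_frag_of sum.neutral)
  \<comment> \<open>The chip found at \<open>y K\<close> is sent to \<open>z K\<close>; the triangle
    inequality charges this to its number \<open>j\<close>.\<close>
  define x'' where "x'' = x'(j := z K)"
  show ?case
  proof (intro exI[of _ x''] conjI allI impI)
    have split: "(\<Sum>i<m. g i) = g j + (\<Sum>i\<in>{..<m} - {j}. g i)" for g :: "nat \<Rightarrow> 'a \<Rightarrow>\<^sub>0 int"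
      using j(1) by (simp add: sum.remove)
    have "(\<Sum>i\<in>{..<m} - {j}. frag_of (x'' i)) = (\<Sum>i\<in>{..<m} - {j}. frag_of (x' i))"
      by (intro sum.cong) (auto simp: x''_def)
    then have "(\<Sum>i<m. frag_of (x'' i)) = (\<Sum>i<m. frag_of (x' i)) - frag_of (y K) + frag_of (z K)"
      using split[of "\<lambda>i. frag_of (x'' i)"] split[of "\<lambda>i. frag_of (x' i)"] j(2)
      by (simp add: x''_def)
    also have "\<dots> = ?E (Suc K)" unfolding x'(1) by simp
    finally show "(\<Sum>i<m. frag_of (x'' i)) = ?E (Suc K)" .
    show "x'' i \<in> x ` {..<m} \<union> z ` {..<Suc K}" if "i < m" for i
      using x'(2)[OF that] by (auto simp: x''_def)
    have "(\<Sum>i<m. dist (x i) (x'' i)) \<le>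
        (\<Sum>i<m. dist (x i) (x' i) + (if i = j then dist (y K) (z K) else 0))"
      using j(2) by (intro sum_mono) (auto simp: x''_def dist_triangle)
    also have "\<dots> = (\<Sum>i<m. dist (x i) (x' i)) + dist (y K) (z K)"
      using j(1) by (simp add: sum.distrib)
    also have "\<dots> \<le> (\<Sum>k<Suc K. dist (y k) (z k))" using x'(3) by simp
    finally show "(\<Sum>i<m. dist (x i) (x'' i)) \<le> (\<Sum>k<Suc K. dist (y k) (z k))" .
  qed
qed

text \<open>A path of finite total length is Cauchy: distances are bounded by blocks of the
  series.\<close>

lemma summable_dist_imp_convergent:
  fixes x :: "nat \<Rightarrow> 'a::metric_space"
  assumes S: "complete S" "\<And>i. x i \<in> S" and sum: "summable (\<lambda>i. dist (x i) (x (Suc i)))"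
  obtains l where "l \<in> S" "x \<longlonglongrightarrow> l"
proof -
  have le: "dist (x a) (x b) \<le> (\<Sum>i=a..<b. dist (x i) (x (Suc i)))" if "a \<le> b" for a b
    using that
  proof (induction rule: dec_induct)
    case (step b)
    then show ?case using dist_triangle[of "x a" "x (Suc b)" "x b"] by simp
  qed simp
  have "Cauchy x"
    unfolding Cauchy_altdef
  proof (intro allI impI)
    fix e :: real assume "0 < e"
    then obtain N where N: "\<And>a b. N \<le> a \<Longrightarrow> norm (\<Sum>i=a..<b. dist (x i) (x (Suc i))) < e"
      using sum unfolding summable_Cauchy by metis
    have "dist (x a) (x b) < e" if "N \<le> a" "a < b" for a b
      using le[of a b] N[OF that(1), of b] that(2) by simp
    then show "\<exists>N. \<forall>a\<ge>N. \<forall>b>a. dist (x a) (x b) < e" by blast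
  qed
  then show ?thesis using S that unfolding complete_def by metis
qed

locale legal_reduction = edge_presentation +
  fixes q :: 'a and Ds :: "nat \<Rightarrow> ('a \<Rightarrow>\<^sub>0 int)" and f :: "nat \<Rightarrow> 'a firing"
  assumes q_in_\<Gamma>: "q \<in> \<Gamma>"
    and div_0: "divisor_on \<Gamma> (Ds 0)"
    and nonneg_0: "nonneg_off q (Ds 0)"
    and legal: "legal_firing \<Gamma> q (Ds i) (f i)"
    and Ds_Suc: "Ds (Suc i) = Ds i - firing_div (f i)"
begin

section \<open>Invariants of a legal reduction\<close>

lemma graph_firing_f: "graph_firing \<Gamma> V n w \<phi> q (f i)"
  using legal[of i] unfolding legal_firing_def
  by (intro graph_firing.intro edge_presentation_axioms graph_firing_axioms.intro) blast

lemma keys_firing_div: "Poly_Mapping.keys (firing_div (f i)) \<subseteq> \<Gamma>"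
proof -
  interpret graph_firing \<Gamma> V n w \<phi> q "f i" by (rule graph_firing_f)
  have "Poly_Mapping.keys (frag_of (seg k \<epsilon>) - frag_of (seg k 0)) \<subseteq> \<Gamma>" if "k < fnum (f i)" for k
    by (rule subset_trans[OF keys_diff]) (use seg_props(2,3)[OF that] X_subset Y_subset in auto)
  then show ?thesis
    using keys_sum[of "\<lambda>k. frag_of (seg k \<epsilon>) - frag_of (seg k 0)" "{..<fnum (f i)}"]
    unfolding firing_div_def by blast
qed

lemma lookup_firing_div_q: "Poly_Mapping.lookup (firing_div (f i)) q \<le> 0"
proof -
  interpret graph_firing \<Gamma> V n w \<phi> q "f i" by (rule graph_firing_f)
  have "Poly_Mapping.lookup (frag_of (seg k \<epsilon>) - frag_of (seg k 0)) q \<le> 0"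
    if "k < fnum (f i)" for k
  proof -
    have "q \<noteq> seg k \<epsilon>" using seg_props(3)[OF that] q_in_X XY_disjoint by auto
    then show ?thesis by (simp add: lookup_minus)
  qed
  then show ?thesis unfolding firing_div_def lookup_sum by (intro sum_nonpos) auto
qed

lemma keys_Ds: "Poly_Mapping.keys (Ds i) \<subseteq> \<Gamma>"
proof (induction i)
  case 0
  then show ?case using div_0 unfolding divisor_on_def .
next
  case (Suc i)
  then show ?case using keys_diff[of "Ds i" "firing_div (f i)"] keys_firing_div[of i]
    unfolding Ds_Suc by blast
qed

lemma nonneg_Ds: "nonneg_off q (Ds i)"
  using nonneg_0 legal[of "i - 1"] Ds_Suc[of "i - 1"] unfolding legal_firing_def by (cases i) auto

lemma lookup_Ds_q: "Poly_Mapping.lookup (Ds 0) q \<le> Poly_Mapping.lookup (Ds i) q"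
proof (induction i)
  case (Suc i)
  then show ?case using lookup_firing_div_q[of i] by (simp add: Ds_Suc lookup_minus)
qed simp

section \<open>The energy estimate for the partial sums\<close>

abbreviation Fs :: "nat \<Rightarrow> 'a \<Rightarrow> real" where
  "Fs N \<equiv> \<lambda>p. \<Sum>i<N. firing_fun (f i) p"

lemmas pw_affine_f = graph_firing.pw_affine_fun[OF graph_firing_f]

lemma pw_affine_Fs: "pw_affine (Fs N)"
  using pw_affine_f by (rule pw_affine_sum)

lemma firing_fun_nonneg: "p \<in> \<Gamma> \<Longrightarrow> 0 \<le> firing_fun (f i) p"
  by (rule graph_firing.fun_nonneg[OF graph_firing_f])

lemma firing_fun_q: "firing_fun (f i) q = 0"
  by (rule graph_firing.fun_X[OF graph_firing_f graph_firing.q_in_X[OF graph_firing_f]])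

text \<open>Only the coefficient at \<open>q\<close> can be negative, and there the firing function
  vanishes. The two indices are independent so that \<open>j = Suc i\<close> can express
  legality.\<close>

lemma pairing_Ds_nonneg: "0 \<le> div_pairing (Ds j) (firing_fun (f i))"
  unfolding div_pairing_def
proof (rule sum_nonneg)
  fix p assume "p \<in> Poly_Mapping.keys (Ds j)"
  then show "0 \<le> of_int (Poly_Mapping.lookup (Ds j) p) * firing_fun (f i) p"
    using keys_Ds[of j] nonneg_Ds[of j] firing_fun_nonneg[of p i] firing_fun_q[of i]
    unfolding nonneg_off_def by (cases "p = q") auto
qed

lemma energy_f: "pw_affine u \<Longrightarrow> energy (firing_fun (f i)) u = div_pairing (firing_div (f i)) u"
  unfolding div_pairing_firing_div by (rule graph_firing.energy_firing[OF graph_firing_f])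

text \<open>Each chip starts where the firing function is \<open>flen (f i)\<close> and lands where
  it is 0; the value also bounds the total distance moved by the chips.\<close>

lemma pairing_firing_div_self:
  "div_pairing (firing_div (f i)) (firing_fun (f i)) = real (fnum (f i)) * flen (f i)"
proof -
  interpret graph_firing \<Gamma> V n w \<phi> q "f i" by (rule graph_firing_f)
  show ?thesis unfolding div_pairing_firing_div using seg_props(2,3) fun_X fun_Y by simp
qed

lemma Ds_eq: "Ds i = Ds 0 - (\<Sum>j<i. firing_div (f j))"
  by (induction i) (simp_all add: Ds_Suc)

lemma energy_Suc:
  "energy (Fs (Suc i)) (Fs (Suc i)) + real (fnum (f i)) * flen (f i)
     \<le> energy (Fs i) (Fs i) + 2 * div_pairing (Ds 0) (firing_fun (f i))"
proof -
  let ?u = "firing_fun (f i)"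
  have Suc: "energy (Fs (Suc i)) v = energy (Fs i) v + energy ?u v" if "pw_affine v" for v
    using energy_add_left[OF pw_affine_Fs[of i] pw_affine_f[of i] that] by simp
  have 1: "energy (Fs (Suc i)) (Fs (Suc i)) =
      energy (Fs i) (Fs i) + 2 * energy (Fs i) ?u + energy ?u ?u"
    using Suc[OF pw_affine_Fs[of "Suc i"]] Suc[OF pw_affine_Fs[of i]] Suc[OF pw_affine_f[of i]]
      energy_commute[of "Fs i" "Fs (Suc i)"] energy_commute[of ?u "Fs (Suc i)"]
      energy_commute[of ?u "Fs i"]
    by linarith
  have 2: "energy (Fs i) ?u = div_pairing (Ds 0) ?u - div_pairing (Ds i) ?u"
  proof -
    have "energy (Fs i) ?u = (\<Sum>j<i. energy (firing_fun (f j)) ?u)"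
      by (rule energy_sum_left[OF pw_affine_f pw_affine_f])
    also have "\<dots> = div_pairing (\<Sum>j<i. firing_div (f j)) ?u"
      by (simp add: energy_f[OF pw_affine_f] div_pairing_sum)
    finally show ?thesis unfolding Ds_eq[of i] by (simp add: div_pairing_diff)
  qed
  have 3: "energy ?u ?u = real (fnum (f i)) * flen (f i)"
    using energy_f[OF pw_affine_f] pairing_firing_div_self by simp
  \<comment> \<open>Legality: the pairing of \<open>Ds (Suc i)\<close> with \<open>?u\<close> is
    nonnegative.\<close>
  have "real (fnum (f i)) * flen (f i) \<le> div_pairing (Ds i) ?u"
    using pairing_Ds_nonneg[of "Suc i" i] pairing_firing_div_self[of i]
    unfolding Ds_Suc div_pairing_diff by simp
  \<comment> \<open>The term \<open>- 2 * div_pairing (Ds i) ?u\<close> pays both for the energy of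
    \<open>?u\<close> and for the added travel.\<close>
  then show ?thesis using 1 2 3 by linarith
qed

lemma energy_bound:
  "energy (Fs N) (Fs N) + (\<Sum>i<N. real (fnum (f i)) * flen (f i)) \<le> 2 * div_pairing (Ds 0) (Fs N)"
proof (induction N)
  case 0
  then show ?case by (simp add: energy_zero_left div_pairing_def)
next
  case (Suc N)
  then show ?case using energy_Suc[of N] unfolding div_pairing_fun_sum by simp
qed

lemma travel_nonneg: "0 \<le> real (fnum (f i)) * flen (f i)"
  using graph_firing.\<epsilon>_pos[OF graph_firing_f, of i] by simp

text \<open>\<open>Fs N\<close> vanishes at \<open>q\<close>, so at each point of the support of
  \<open>Ds 0\<close> it is at most a constant times the root of its energy; the constants are
  weighted by the coefficients.\<close>

lemma pairing_Fs_bound: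
  obtains C where "0 \<le> C" "\<And>N. div_pairing (Ds 0) (Fs N) \<le> C * sqrt (energy (Fs N) (Fs N))"
proof -
  have "\<exists>C\<ge>0. \<forall>u. pw_affine u \<longrightarrow> \<bar>u p - u q\<bar> \<le> C * sqrt (energy u u)" if "p \<in> \<Gamma>" for p
    using diff_le_sqrt_energy[OF that q_in_\<Gamma>] by metis
  then obtain c where c: "\<And>p. p \<in> \<Gamma> \<Longrightarrow> 0 \<le> c p"
    "\<And>p u. p \<in> \<Gamma> \<Longrightarrow> pw_affine u \<Longrightarrow> \<bar>u p - u q\<bar> \<le> c p * sqrt (energy u u)" by metis
  let ?C = "\<Sum>p\<in>Poly_Mapping.keys (Ds 0). \<bar>of_int (Poly_Mapping.lookup (Ds 0) p)\<bar> * c p"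
  show ?thesis
  proof (rule that[of ?C])
    show "0 \<le> ?C" using c(1) keys_Ds[of 0] by (intro sum_nonneg mult_nonneg_nonneg) auto
    fix N
    have "div_pairing (Ds 0) (Fs N) \<le>
        (\<Sum>p\<in>Poly_Mapping.keys (Ds 0). \<bar>of_int (Poly_Mapping.lookup (Ds 0) p)\<bar> *
          (c p * sqrt (energy (Fs N) (Fs N))))"
      unfolding div_pairing_def
    proof (rule sum_mono)
      fix p assume "p \<in> Poly_Mapping.keys (Ds 0)"
      then have "\<bar>Fs N p\<bar> \<le> c p * sqrt (energy (Fs N) (Fs N))"
        using c(2)[OF _ pw_affine_Fs, of p N] keys_Ds[of 0] firing_fun_q by auto
      then have "\<bar>of_int (Poly_Mapping.lookup (Ds 0) p)\<bar> * \<bar>Fs N p\<bar> \<le>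
          \<bar>of_int (Poly_Mapping.lookup (Ds 0) p)\<bar> * (c p * sqrt (energy (Fs N) (Fs N)))"
        by (intro mult_left_mono) auto
      then show "of_int (Poly_Mapping.lookup (Ds 0) p) * Fs N p \<le>
          \<bar>of_int (Poly_Mapping.lookup (Ds 0) p)\<bar> * (c p * sqrt (energy (Fs N) (Fs N)))"
        using abs_ge_self[of "of_int (Poly_Mapping.lookup (Ds 0) p) * Fs N p"]
        unfolding abs_mult by linarith
    qed
    then show "div_pairing (Ds 0) (Fs N) \<le> ?C * sqrt (energy (Fs N) (Fs N))"
      by (simp add: sum_distrib_right mult.assoc)
  qed
qed

lemma energy_Fs_bounded:
  obtains C where "0 \<le> C" "\<And>N. sqrt (energy (Fs N) (Fs N)) \<le> C"
    "\<And>N. (\<Sum>i<N. real (fnum (f i)) * flen (f i)) \<le> C * C"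
proof -
  obtain C where C: "0 \<le> C" "\<And>N. div_pairing (Ds 0) (Fs N) \<le> C * sqrt (energy (Fs N) (Fs N))"
    using pairing_Fs_bound by metis
  have s: "sqrt (energy (Fs N) (Fs N)) \<le> 2 * C" for N
  proof -
    let ?r = "sqrt (energy (Fs N) (Fs N))"
    \<comment> \<open>The energy is bounded by a multiple of its own root; cancelling one factor
      bounds the root.\<close>
    have "?r * ?r \<le> 2 * C * ?r"
      using energy_bound[of N] C(2)[of N] sum_nonneg[of "{..<N}" "\<lambda>i. real (fnum (f i)) * flen (f i)"]
        travel_nonneg energy_nonneg[of "Fs N"] by simp
    moreover have "0 \<le> ?r" using energy_nonneg by simp
    ultimately show ?thesis
      using C(1) mult_right_le_imp_le[of ?r ?r "2 * C"] by (cases "?r = 0") linarith+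
  qed
  have "(\<Sum>i<N. real (fnum (f i)) * flen (f i)) \<le> 2 * C * (2 * C)" for N
  proof -
    have "(\<Sum>i<N. real (fnum (f i)) * flen (f i)) \<le> 2 * (C * sqrt (energy (Fs N) (Fs N)))"
      using energy_bound[of N] C(2)[of N] energy_nonneg[of "Fs N"] by linarith
    also have "\<dots> \<le> 2 * (C * (2 * C))" using s[of N] C(1) by (intro mult_left_mono) auto
    finally show ?thesis by simp
  qed
  then show ?thesis using that[of "2 * C"] C(1) s by auto
qed

text \<open>The terms are nonnegative, and the partial sums are bounded through their energy because
  they vanish at \<open>q\<close>.\<close>

lemma summable_firing_fun:
  assumes p: "p \<in> \<Gamma>" shows "summable (\<lambda>i. firing_fun (f i) p)"
proof -
  obtain C where C: "0 \<le> C" "\<And>N. sqrt (energy (Fs N) (Fs N)) \<le> C"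
    using energy_Fs_bounded by metis
  obtain c where c: "0 \<le> c" "\<And>u. pw_affine u \<Longrightarrow> \<bar>u p - u q\<bar> \<le> c * sqrt (energy u u)"
    using diff_le_sqrt_energy[OF p q_in_\<Gamma>] by metis
  have "Fs N p \<le> c * C" for N
  proof -
    have "\<bar>Fs N p\<bar> \<le> c * sqrt (energy (Fs N) (Fs N))"
      using c(2)[OF pw_affine_Fs, of N] firing_fun_q by simp
    also have "\<dots> \<le> c * C" using c(1) C(2) by (intro mult_left_mono) auto
    finally show ?thesis by simp
  qed
  then show ?thesis using firing_fun_nonneg[OF p] by (intro summableI_nonneg_bounded)
qed

lemma summable_travel: "summable (\<lambda>i. real (fnum (f i)) * flen (f i))"
proof -
  obtain C where "\<And>N. (\<Sum>i<N. real (fnum (f i)) * flen (f i)) \<le> C * C"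
    using energy_Fs_bounded by metis
  then show ?thesis using travel_nonneg by (intro summableI_nonneg_bounded)
qed

section \<open>Convergence of the chips\<close>

lemma move_chips_firing:
  fixes m :: nat
  assumes x: "Ds i + Poly_Mapping.single q N = (\<Sum>j<m. frag_of (x j))" "\<forall>j<m. x j \<in> \<Gamma>"
    and N: "\<And>p. 0 \<le> Poly_Mapping.lookup (Ds (Suc i) + Poly_Mapping.single q N) p"
  shows "\<exists>x'. (Ds (Suc i) + Poly_Mapping.single q N = (\<Sum>j<m. frag_of (x' j)) \<and>
      (\<forall>j<m. x' j \<in> \<Gamma>)) \<and> (\<Sum>j<m. dist (x j) (x' j)) \<le> real (fnum (f i)) * flen (f i)"
proof -
  interpret graph_firing \<Gamma> V n w \<phi> q "f i" by (rule graph_firing_f)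
  have eq: "Ds (Suc i) + Poly_Mapping.single q N = (\<Sum>j<m. frag_of (x j)) -
      (\<Sum>k<fnum (f i). frag_of (seg k \<epsilon>) - frag_of (seg k 0))"
    unfolding Ds_Suc x(1)[symmetric] firing_div_def by simp
  \<comment> \<open>Chips depart from \<open>Y\<close> and land in \<open>X\<close>, which are
    disjoint.\<close>
  have ne: "seg k \<epsilon> \<noteq> seg l 0" if "k < fnum (f i)" "l < fnum (f i)" for k l
    using seg_props(2)[OF that(2)] seg_props(3)[OF that(1)] XY_disjoint by auto
  obtain x' where x': "(\<Sum>j<m. frag_of (x' j)) = (\<Sum>j<m. frag_of (x j)) -
      (\<Sum>k<fnum (f i). frag_of (seg k \<epsilon>) - frag_of (seg k 0))"
    "\<And>j. j < m \<Longrightarrow> x' j \<in> x ` {..<m} \<union> (\<lambda>k. seg k 0) ` {..<fnum (f i)}"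
    "(\<Sum>j<m. dist (x j) (x' j)) \<le> (\<Sum>k<fnum (f i). dist (seg k \<epsilon>) (seg k 0))"
    using move_chips[of x m "\<lambda>k. seg k \<epsilon>" "\<lambda>k. seg k 0" "fnum (f i)", OF N[unfolded eq] ne]
    by blast
  have "(\<Sum>k<fnum (f i). dist (seg k \<epsilon>) (seg k 0)) \<le> (\<Sum>k<fnum (f i). \<epsilon>)"
    using dist_seg_le by (intro sum_mono) auto
  then have "(\<Sum>j<m. dist (x j) (x' j)) \<le> real (fnum (f i)) * \<epsilon>" using x'(3) by simp
  moreover have "x ` {..<m} \<union> (\<lambda>k. seg k 0) ` {..<fnum (f i)} \<subseteq> \<Gamma>"
    using x(2) seg_props(2) X_subset by auto
  then have "\<forall>j<m. x' j \<in> \<Gamma>" using x'(2) by (meson subsetD)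
  ultimately show ?thesis using x'(1) eq by (intro exI[of _ x']) simp
qed

lemma divisors_convergent:
  assumes N: "N = max 0 (- Poly_Mapping.lookup (Ds 0) q)"
  obtains Dlim where "divisor_on \<Gamma> Dlim" "divisors_converge \<Gamma> q N Ds Dlim"
proof -
  \<comment> \<open>The coefficient at \<open>q\<close> never drops below its initial value, so the
    same \<open>N\<close> makes all \<open>Ds i\<close> effective.\<close>
  have nonneg: "0 \<le> Poly_Mapping.lookup (Ds i + Poly_Mapping.single q N) p" for i p
  proof (cases "p = q")
    case True
    have "Poly_Mapping.lookup (Ds i + Poly_Mapping.single q N) q = Poly_Mapping.lookup (Ds i) q + N"
      by (simp add: lookup_add)
    then show ?thesis unfolding True using lookup_Ds_q[of i] N by linarith
  next
    case False
    then show ?thesis using nonneg_Ds[of i] unfolding nonneg_off_def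
      by (simp add: lookup_add lookup_single_not_eq)
  qed
  have keys: "Poly_Mapping.keys (D + Poly_Mapping.single q c) \<subseteq> \<Gamma>"
    if "Poly_Mapping.keys D \<subseteq> \<Gamma>" for D and c :: int
    using Poly_Mapping.keys_add[of D "Poly_Mapping.single q c"] that q_in_\<Gamma>
    by (auto split: if_splits)
  obtain m :: nat and x0 where x0: "Ds 0 + Poly_Mapping.single q N = (\<Sum>j<m. frag_of (x0 j))"
    "\<And>j. j < m \<Longrightarrow> x0 j \<in> Poly_Mapping.keys (Ds 0 + Poly_Mapping.single q N)"
    using effective_eq_sum_frag_of[OF nonneg] by metis
  \<comment> \<open>The numbering of the chips is chosen successively, each one matched to the
    previous one so that the summed displacement is at most the travel of the firing.\<close>
  have "\<exists>x. \<forall>i. (Ds i + Poly_Mapping.single q N = (\<Sum>j<m. frag_of (x i j)) \<and> (\<forall>j<m. x i j \<in> \<Gamma>)) \<and>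
      (\<Sum>j<m. dist (x i j) (x (Suc i) j)) \<le> real (fnum (f i)) * flen (f i)"
  proof (rule dependent_nat_choice)
    show "\<exists>x. Ds 0 + Poly_Mapping.single q N = (\<Sum>j<m. frag_of (x j)) \<and> (\<forall>j<m. x j \<in> \<Gamma>)"
      using x0 keys[OF keys_Ds] by blast
  next
    fix x i
    assume x: "Ds i + Poly_Mapping.single q N = (\<Sum>j<m. frag_of (x j)) \<and> (\<forall>j<m. x j \<in> \<Gamma>)"
    show "\<exists>y. (Ds (Suc i) + Poly_Mapping.single q N = (\<Sum>j<m. frag_of (y j)) \<and> (\<forall>j<m. y j \<in> \<Gamma>)) \<and>
        (\<Sum>j<m. dist (x j) (y j)) \<le> real (fnum (f i)) * flen (f i)"
      by (rule move_chips_firing[OF conjunct1[OF x] conjunct2[OF x] nonneg])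
  qed
  then obtain x where "\<forall>i. (Ds i + Poly_Mapping.single q N = (\<Sum>j<m. frag_of (x i j)) \<and>
      (\<forall>j<m. x i j \<in> \<Gamma>)) \<and>
      (\<Sum>j<m. dist (x i j) (x (Suc i) j)) \<le> real (fnum (f i)) * flen (f i)" ..
  then have x: "\<And>i. Ds i + Poly_Mapping.single q N = (\<Sum>j<m. frag_of (x i j))"
    "\<And>i j. j < m \<Longrightarrow> x i j \<in> \<Gamma>"
    "\<And>i. (\<Sum>j<m. dist (x i j) (x (Suc i) j)) \<le> real (fnum (f i)) * flen (f i)"
    by blast+
  have "\<exists>l. l \<in> \<Gamma> \<and> (\<lambda>i. x i j) \<longlonglongrightarrow> l" if j: "j < m" for j
  proof -
    have "dist (x i j) (x (Suc i) j) \<le> real (fnum (f i)) * flen (f i)" for i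
      using member_le_sum[of j "{..<m}" "\<lambda>j. dist (x i j) (x (Suc i) j)"] j x(3)[of i] by simp
    then have "summable (\<lambda>i. dist (x i j) (x (Suc i) j))"
      by (intro summable_comparison_test'[OF summable_travel]) auto
    then show ?thesis
      using summable_dist_imp_convergent[OF compact_imp_complete[OF compact_\<Gamma>], of "\<lambda>i. x i j"]
        x(2)[OF j] by blast
  qed
  then obtain l where l: "\<And>j. j < m \<Longrightarrow> l j \<in> \<Gamma>" "\<And>j. j < m \<Longrightarrow> (\<lambda>i. x i j) \<longlonglongrightarrow> l j"
    by metis
  \<comment> \<open>The limit of the chips, with the \<open>N\<close> auxiliary chips at
    \<open>q\<close> taken away again.\<close>
  define Dlim where "Dlim = (\<Sum>j<m. frag_of (l j)) + Poly_Mapping.single q (- N)"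
  have "Poly_Mapping.keys (\<Sum>j<m. frag_of (l j)) \<subseteq> \<Gamma>"
    using keys_sum[of "\<lambda>j. frag_of (l j)" "{..<m}"] l(1) by fastforce
  then have "divisor_on \<Gamma> Dlim" unfolding divisor_on_def Dlim_def by (rule keys)
  moreover have "Dlim + Poly_Mapping.single q N = (\<Sum>j<m. frag_of (l j))"
    by (simp add: Dlim_def add.assoc single_add[symmetric])
  then have "divisors_converge \<Gamma> q N Ds Dlim"
    unfolding divisors_converge_def using x(1,2) l
    by (intro exI[of _ m] exI[of _ x] exI[of _ l]) blast
  ultimately show ?thesis using that by blast
qed

end

theorem lemma1:
  fixes \<Gamma> :: "'a::metric_space set"
    and q :: 'a
    and D :: "'a \<Rightarrow>\<^sub>0 int"
    and Ds :: "nat \<Rightarrow> ('a \<Rightarrow>\<^sub>0 int)"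
    and f :: "nat \<Rightarrow> 'a firing"
  assumes "metric_graph \<Gamma>"
    and "q \<in> \<Gamma>"
    and "divisor_on \<Gamma> D"
    and "nonneg_off q D"
    and "Ds 0 = D"
    and "\<And>i. maximal_legal_firing \<Gamma> q (Ds i) (f i)"
    and "\<And>i. Ds (Suc i) = Ds i - firing_div (f i)"
  shows "(\<forall>p\<in>\<Gamma>. summable (\<lambda>i. firing_fun (f i) p)) \<and>
         (\<exists>Dlim. divisor_on \<Gamma> Dlim \<and>
               divisors_converge \<Gamma> q (max 0 (- Poly_Mapping.lookup D q)) Ds Dlim)"
proof -
  obtain V n w \<phi> where "compact \<Gamma>" "finite V"
    "\<forall>e<n. 0 < w e \<and> \<phi> e 0 \<in> V \<and> \<phi> e (w e) \<in> V"
    "\<forall>e<n. \<forall>t\<in>{0<..<w e}. \<phi> e t \<notin> V"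
    "inj_on (\<lambda>(e, t). \<phi> e t) (SIGMA e:{..<n}. {0<..<w e})"
    "\<Gamma> = V \<union> (\<Union>e<n. \<phi> e ` {0..w e})"
    "\<forall>x\<in>\<Gamma>. \<forall>y\<in>\<Gamma>. (\<exists>l. edge_walk n w \<phi> x y l) \<and>
        dist x y = Inf {l. edge_walk n w \<phi> x y l}"
    using assms(1) unfolding metric_graph_def by (elim conjE exE) (rule that)
  then have "edge_presentation \<Gamma> V n w \<phi>" by (intro edge_presentation.intro) blast+
  then interpret legal_reduction \<Gamma> V n w \<phi> q Ds f
    using assms(2-7) unfolding maximal_legal_firing_def
    by (intro legal_reduction.intro legal_reduction_axioms.intro) auto
  show ?thesis
  proof (intro conjI ballI)
    show "summable (\<lambda>i. firing_fun (f i) p)" if "p \<in> \<Gamma>" for p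
      using that by (rule summable_firing_fun)
    show "\<exists>Dlim. divisor_on \<Gamma> Dlim \<and>
        divisors_converge \<Gamma> q (max 0 (- Poly_Mapping.lookup D q)) Ds Dlim"
      using divisors_convergent[OF refl] unfolding assms(5) by blast
  qed
qed

end
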